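(* Let $p\in(\vec{p}_c,1)$ and let $G$ be the random oriented graph formed by the right-most infinite open paths $\gamma_u$, $u\in\mathcal{K}$, of oriented percolation with parameter $p$ on $\mathcal{L}$. Then, almost surely, $G$ has a unique infinite succession line. The maps $\Pi(u,G)=u'$ (the successor of $u$) and $\Pi^{-1}(u',G)=u$ (the predecessor of $u'$) are well-defined on $\mathcal{K}$, and one is the inverse of the other. Furthermore, $\mathcal{K}=\{\Pi^n(u,G):n\in\mathbb{Z}\}$ for all $u\in\mathcal{K}$.
   Context: Oriented percolation. Let $\mathcal{L}=\{(m,n)\in\mathbb{Z}^2: m+n \text{ is even}\}$, with oriented edges from $(m,n)$ to $(m+1,n+1)$ and to $(m-1,n+1)$. Each edge is independently open with probability $p$ and closed with probability $1-p$; $\mathbb{P}_p$ is the product measure. For $u,v\in\mathcal{L}$ write $u\to v$ if there is a (possibly trivial) oriented path of open edges from $u$ to $v$. Let $C_u=\{v\in\mathcal{L}:u\to v\}$, $\theta(p)=\mathbb{P}_p(|C_{(0,0)}|=\infty)$, and $\vec{p}_c=\sup\{p:\theta(p)=0\}$; it is known that $0<\vec{p}_c<1$. A vertex $u$ is a percolation point if $|C_u|=\infty$, and $\mathcal{K}=\{u\in\mathcal{L}:|C_u|=\infty\}$. Right-most paths. For $(x,y)\in\mathcal{K}$, the right-most infinite open path $\gamma_{(x,y)}$ is the infinite oriented open path with vertices $v_0=(x,y),v_1,v_2,\dots$, $v_n=(x_n,y_n)$ (each edge from $v_{n-1}$ to $v_n$ being an open oriented edge), such that for every $n\ge 1$ there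 is no integer $k\ge1$ with $(x,y)\to(x_n+k,y_n)$ and $(x_n+k,y_n)\in\mathcal{K}$. The graph $G$. $G$ is the union of the paths $\gamma_u$, $u\in\mathcal{K}$: its vertex set is $\mathcal{K}$ and its edges are the (open) edges belonging to some $\gamma_u$, $u\in\mathcal{K}$. Each vertex $u$ of $G$ is the starting point of exactly one edge of $G$; the other endpoint of that edge is the mother $M(u)$ of $u$. If $M(v)=u$ then $v$ is a daughter of $u$; each vertex $u=(m,n)$ has at most two daughters, which lie among $(m-1,n-1)$ and $(m+1,n-1)$. If $u$ has two daughters they are sisters; $(m-1,n-1)$ is the older sister and $(m+1,n-1)$ is the younger sister. Set $M^0(u)=u$, $M^n(u)=M(M^{n-1}(u))$ for $n\ge1$. Almost surely, any two vertices $u,v$ of $G$ have a common ancestor, i.e. $M^i(u)=M^j(v)$ for some $i,j\ge0$. Order. For a vertex $u$ of $G$ let $\sigma(u)=1$ if $u$ has a sister and is the older one, and $\sigma(u)=2$ otherwise. Let $\sigma_i(u)=\sigma(M^i(u))$ for $i\ge0$ and $\sigma_{-1}(u)=0$. For vertices $u,v$ of $G$, let $z=M^i(u)=M^j(v)$ be their closest common ancestor ($i,j\ge0$ minimal). We say $u$ precedes $v$ if $\sigma_{i-1}(u)<\sigma_{j-1}(v)$. The successor of $u\in\mathcal{K}$ is the vertex $u'\in\mathcal{K}$ such that $u$ precedes $u'$ and there is no vertex $w$ such that $u$ precedes $w$ and $w$ precedes $u'$. Conversely, $u$ is the predecessor of $u'$ if and only if $u'$ is the successor of $u$. Succession lines.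 There is a succession line from $u$ to $v$ if there is a finite sequence of vertices $u=v_0,\dots,v_k=v$ such that $v_{i-1}$ is the successor of $v_i$ for $i=1,\dots,k$. $G$ has a unique infinite succession line if for every couple of vertices $u$ and $v$ there is a unique succession line either from $u$ to $v$ or from $v$ to $u$. $\Pi^n(\cdot,G)$ for $n\ge 0$ is the $n$-fold iterate of $\Pi(\cdot,G)$, and for $n<0$ the $|n|$-fold iterate of $\Pi^{-1}(\cdot,G)$. *)

theory Defs
  imports "HOL-Probability.Probability" "Graph_Theory.Pair_Digraph"
begin

type_synonym vertex = "int \<times> int"
type_synonym edge = "vertex \<times> vertex"
type_synonym config = "edge \<Rightarrow> bool"

section \<open>Oriented percolation\<close>

definition lattice :: "vertex set" where
  "lattice = {(m, n). even (m + n)}"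

definition lattice_edges :: "edge set" where
  "lattice_edges = {((m, n), (m', n')). (m, n) \<in> lattice \<and> n' = n + 1 \<and> (m' = m + 1 \<or> m' = m - 1)}"

definition percolation :: "real \<Rightarrow> config measure" where
  "percolation p = (\<Pi>\<^sub>M e \<in> lattice_edges. measure_pmf (bernoulli_pmf p))"

definition open_edges :: "config \<Rightarrow> edge set" where
  "open_edges \<omega> = {e \<in> lattice_edges. \<omega> e}"

definition connects :: "config \<Rightarrow> vertex \<Rightarrow> vertex \<Rightarrow> bool" where
  "connects \<omega> u v \<longleftrightarrow> u \<in> lattice \<and> v \<in> lattice \<and> (u, v) \<in> (open_edges \<omega>)\<^sup>*"

definition cluster :: "config \<Rightarrow> vertex \<Rightarrow> vertex set" where
  "cluster \<omega> u = {v \<in> lattice. connects \<omega> u v}"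

definition theta :: "real \<Rightarrow> real" where
  "theta p = \<P>(\<omega> in percolation p. infinite (cluster \<omega> (0, 0)))"

text \<open>\<^const>\<open>bernoulli_pmf\<close> truncates its parameter to the unit interval, so the range of the
  parameter has to be written out: otherwise all negative numbers would belong to the set.\<close>

definition critical_prob :: real where
  "critical_prob = Sup {p \<in> {0..1}. theta p = 0}"

definition percolation_points :: "config \<Rightarrow> vertex set" where
  "percolation_points \<omega> = {u \<in> lattice. infinite (cluster \<omega> u)}"

section \<open>Right-most infinite open paths and their union\<close>

definition rightmost_path :: "config \<Rightarrow> vertex \<Rightarrow> (nat \<Rightarrow> vertex) \<Rightarrow> bool" where
  "rightmost_path \<omega> u v \<longleftrightarrow>
     v 0 = u \<and>
     (\<forall>n\<ge>1. (v (n - 1), v n) \<in> open_edges \<omega>) \<and>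
     (\<forall>n\<ge>1. \<not> (\<exists>k::int. k \<ge> 1 \<and>
        connects \<omega> u (fst (v n) + k, snd (v n)) \<and>
        (fst (v n) + k, snd (v n)) \<in> percolation_points \<omega>))"

text \<open>Every percolation point is the start of exactly one right-most path, so the description
  below is meaningful on \<^const>\<open>percolation_points\<close>, the only place where it is used.\<close>

definition gamma :: "config \<Rightarrow> vertex \<Rightarrow> nat \<Rightarrow> vertex" where
  "gamma \<omega> u = (THE v. rightmost_path \<omega> u v)"

definition rightmost_graph :: "config \<Rightarrow> vertex pair_pre_digraph" where
  "rightmost_graph \<omega> =
     \<lparr> pverts = percolation_points \<omega>,
       parcs = {(gamma \<omega> u n, gamma \<omega> u (Suc n)) | u n. u \<in> percolation_points \<omega>} \<rparr>"

section \<open>Genealogy and order\<close>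

text \<open>Written for an arbitrary directed graph on the lattice, but only meaningful when every vertex
  is the tail of exactly one arc, as in \<^const>\<open>rightmost_graph\<close>.\<close>

definition mother :: "vertex pair_pre_digraph \<Rightarrow> vertex \<Rightarrow> vertex" where
  "mother G u = (THE w. (u, w) \<in> parcs G)"

definition daughters :: "vertex pair_pre_digraph \<Rightarrow> vertex \<Rightarrow> vertex set" where
  "daughters G u = {v \<in> pverts G. mother G v = u}"

definition sisters :: "vertex pair_pre_digraph \<Rightarrow> vertex \<Rightarrow> vertex \<Rightarrow> bool" where
  "sisters G u v \<longleftrightarrow> u \<noteq> v \<and> (\<exists>w \<in> pverts G. u \<in> daughters G w \<and> v \<in> daughters G w)"

definition is_older_sister :: "vertex pair_pre_digraph \<Rightarrow> vertex \<Rightarrow> bool" where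
  "is_older_sister G u \<longleftrightarrow>
     (\<exists>v. sisters G u v) \<and> u = (fst (mother G u) - 1, snd (mother G u) - 1)"

definition sigma :: "vertex pair_pre_digraph \<Rightarrow> vertex \<Rightarrow> nat" where
  "sigma G u = (if is_older_sister G u then 1 else 2)"

text \<open>The only negative index in use is \<open>-1\<close>.\<close>

definition sigma_at :: "vertex pair_pre_digraph \<Rightarrow> int \<Rightarrow> vertex \<Rightarrow> nat" where
  "sigma_at G i u = (if i < 0 then 0 else sigma G ((mother G ^^ nat i) u))"

text \<open>The closest common ancestor of \<open>u\<close> and \<open>v\<close> is \<open>M\<^sup>i(u) = M\<^sup>j(v)\<close>.\<close>

definition closest_common_ancestor ::
    "vertex pair_pre_digraph \<Rightarrow> vertex \<Rightarrow> vertex \<Rightarrow> nat \<Rightarrow> nat \<Rightarrow> bool" where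
  "closest_common_ancestor G u v i j \<longleftrightarrow>
     (mother G ^^ i) u = (mother G ^^ j) v \<and>
     (\<forall>i' j'. (mother G ^^ i') u = (mother G ^^ j') v \<longrightarrow> i \<le> i' \<and> j \<le> j')"

definition precedes :: "vertex pair_pre_digraph \<Rightarrow> vertex \<Rightarrow> vertex \<Rightarrow> bool" where
  "precedes G u v \<longleftrightarrow> u \<in> pverts G \<and> v \<in> pverts G \<and>
     (\<exists>i j. closest_common_ancestor G u v i j \<and>
        sigma_at G (int i - 1) u < sigma_at G (int j - 1) v)"

section \<open>Successors and succession lines\<close>

text \<open>\<open>is_successor G u u'\<close> says that \<open>u'\<close> is the successor of \<open>u\<close>; \<open>is_predecessor G u' u\<close>
  that \<open>u\<close> is the predecessor of \<open>u'\<close>.\<close>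

definition is_successor :: "vertex pair_pre_digraph \<Rightarrow> vertex \<Rightarrow> vertex \<Rightarrow> bool" where
  "is_successor G u u' \<longleftrightarrow> u \<in> pverts G \<and> u' \<in> pverts G \<and> precedes G u u' \<and>
     \<not> (\<exists>w \<in> pverts G. precedes G u w \<and> precedes G w u')"

definition is_predecessor :: "vertex pair_pre_digraph \<Rightarrow> vertex \<Rightarrow> vertex \<Rightarrow> bool" where
  "is_predecessor G u' u \<longleftrightarrow> is_successor G u u'"

definition successor :: "vertex \<Rightarrow> vertex pair_pre_digraph \<Rightarrow> vertex" where
  "successor u G = (THE u'. is_successor G u u')"

definition predecessor :: "vertex \<Rightarrow> vertex pair_pre_digraph \<Rightarrow> vertex" where
  "predecessor u' G = (THE u. is_predecessor G u' u)"

definition successor_iterate :: "int \<Rightarrow> vertex \<Rightarrow> vertex pair_pre_digraph \<Rightarrow> vertex" where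
  "successor_iterate n u G =
     (if n \<ge> 0 then ((\<lambda>w. successor w G) ^^ nat n) u
      else ((\<lambda>w. predecessor w G) ^^ nat \<bar>n\<bar>) u)"

text \<open>A line from \<open>u\<close> to \<open>v\<close> starts at the later vertex: each entry is the successor of the
  next one. The one-element line from a vertex to itself is allowed.\<close>

definition succession_line ::
    "vertex pair_pre_digraph \<Rightarrow> vertex \<Rightarrow> vertex \<Rightarrow> vertex list \<Rightarrow> bool" where
  "succession_line G u v vs \<longleftrightarrow>
     vs \<noteq> [] \<and> set vs \<subseteq> pverts G \<and> hd vs = u \<and> last vs = v \<and>
     (\<forall>i. 1 \<le> i \<and> i < length vs \<longrightarrow> is_successor G (vs ! i) (vs ! (i - 1)))"

definition unique_infinite_succession_line :: "vertex pair_pre_digraph \<Rightarrow> bool" where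
  "unique_infinite_succession_line G \<longleftrightarrow>
     (\<forall>u \<in> pverts G. \<forall>v \<in> pverts G.
        \<exists>!vs. succession_line G u v vs \<or> succession_line G v u vs)"

end

theory Submission
  imports Defs
begin

text \<open>
  By planarity the right-most path is greedy: the mother of \<open>u\<close> is the upper right neighbour of \<open>u\<close>
  if the edge to it is open and it percolates, and the upper left neighbour otherwise (\<open>step\<close>,
  \<open>rightmost_path_iff\<close>). So the graph is a translation-covariant forest in which each arc climbs one
  level and whose branches cannot cross, and the order of the vertices is its depth-first order:
  a vertex comes before its descendants, and the branch of the older sister before the branch of
  the younger one. The theorem says that this order has the type of the integers.

  Two properties of the forest are enough for that. Call a vertex ancient if it has descendants
  in every generation, and call it permanently right-most if for every \<open>n\<close> it is the right-most of
  the \<open>n\<close>-th generation descendants of its \<open>n\<close>-th ancestor. If no vertex is permanently right-most,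
  then any two vertices have a common ancestor: of the vertices between two given ones that coalesce
  with the left one, the right-most would otherwise be permanently right-most. It also follows that
  the order has no last element, since each vertex is followed by a vertex to its right on the
  same level. If no vertex is ancient, then each vertex has only finitely many descendants; together
  with common ancestors, this makes the intervals of the order finite
  (\<open>coalescing_forest\<close>, \<open>succession_structure\<close>).

  For \<open>0 < p < 1\<close> both properties hold almost surely, by stationarity and finite energy.
  The first step transports mass: let each ancient vertex send a unit to its mother, which is ancient
  too. The mean mass received equals the mean mass sent, so almost surely no vertex has two ancient
  daughters (\<open>AE_never_merges\<close>). The second step is deterministic: if two ancient vertices lie
  on the same level, then opening a straight segment from the left one to the path of the right one,
  and closing the other edges that lead into it, makes their lines merge (\<open>merging_modification\<close>).
  Since a change of finitely many edges preserves almost sure events, each level almost surely contains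
  at most one ancient vertex, and by stationarity none. The last step is a second mass transport: the
  probability that a vertex is right-most after \<open>n\<close> generations is at most the probability that a
  vertex has descendants \<open>n\<close> generations back, which tends to the probability of being ancient, and
  that is zero.

  For \<open>p \<le> 0\<close> no edge is open and there are no percolation points at all.
\<close>

section \<open>Discrete linear orders without endpoints\<close>

text \<open>
  A nonempty order of this kind is isomorphic to the integers: finite intervals give every element an
  immediate successor and an immediate predecessor, and no element is out of reach of these.
\<close>
locale discrete_order =
  fixes K :: "'a set" and lt :: "'a \<Rightarrow> 'a \<Rightarrow> bool"
  assumes irrefl: "x \<in> K \<Longrightarrow> \<not> lt x x"
    and trans: "\<lbrakk>x \<in> K; y \<in> K; z \<in> K; lt x y; lt y z\<rbrakk> \<Longrightarrow> lt x z"
    and total: "\<lbrakk>x \<in> K; y \<in> K\<rbrakk> \<Longrightarrow> lt x y \<or> x = y \<or> lt y x"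
    and finite_interval: "\<lbrakk>x \<in> K; y \<in> K\<rbrakk> \<Longrightarrow> finite {w \<in> K. lt x w \<and> lt w y}"
    and no_last: "x \<in> K \<Longrightarrow> \<exists>y\<in>K. lt x y"
    and no_first: "x \<in> K \<Longrightarrow> \<exists>y\<in>K. lt y x"
begin

lemma dual: "discrete_order K (\<lambda>x y. lt y x)"
proof
  fix x y z assume "x \<in> K" "y \<in> K" "z \<in> K" "lt y x" "lt z y"
  then show "lt z x" using trans by blast
next
  fix x y assume "x \<in> K" "y \<in> K"
  then show "finite {w \<in> K. lt w x \<and> lt y w}"
    using finite_interval[of y x] by (simp add: conj_commute)
qed (use irrefl total no_last no_first in blast)+

text \<open>
  The successor is the least element of a finite set: some larger element together with the interval
  in front of it.
\<close>
lemma ex_cover: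
  assumes "u \<in> K"
  shows "\<exists>s. s \<in> K \<and> lt u s \<and> (\<forall>w\<in>K. lt u w \<longrightarrow> w = s \<or> lt s w)"
proof -
  obtain v where uv: "u \<in> K" "v \<in> K" "lt u v" using assms no_last by blast
  define A where "A = insert v {w \<in> K. lt u w \<and> lt w v}"
  have AK: "A \<subseteq> K" "\<And>w. w \<in> A \<Longrightarrow> lt u w" using uv by (auto simp: A_def)
  have "finite A" "A \<noteq> {}" using finite_interval[OF uv(1,2)] by (simp_all add: A_def)
  moreover have "transp_on A lt" by (rule transp_onI) (use trans AK(1) in blast)
  moreover have "asymp_on A lt" by (rule asymp_onI) (use irrefl trans AK(1) in blast)
  ultimately obtain s where s: "s \<in> A" "\<forall>w\<in>A. w \<noteq> s \<longrightarrow> \<not> lt w s"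
    using Finite_Set.bex_min_element[of A lt] by blast
  have "w = s \<or> lt s w" if "w \<in> K" "lt u w" for w
  proof (rule ccontr)
    assume not: "\<not> (w = s \<or> lt s w)"
    with total that s(1) AK have ws: "lt w s" by blast
    have "s = v \<or> lt s v" using s(1) by (auto simp: A_def)
    then have "lt w v" using trans[OF that(1) _ uv(2) ws] ws s(1) AK(1) by blast
    then have "w \<in> A" using that by (simp add: A_def)
    with s(2) ws not show False by blast
  qed
  with s(1) AK show ?thesis by blast
qed

text \<open>
  An element that is larger than \<open>g 0\<close> but missed by the sequence would stay larger than all of it,
  and an interval would be infinite.
\<close>
lemma cover_sequence_exhausts:
  assumes g: "\<And>n. g n \<in> K" "\<And>n. lt (g n) (g (Suc n))"
      "\<And>n w. \<lbrakk>w \<in> K; lt (g n) w\<rbrakk> \<Longrightarrow> w = g (Suc n) \<or> lt (g (Suc n)) w"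
    and u: "u \<in> K" "lt (g 0) u"
  shows "\<exists>n. u = g n"
proof (rule ccontr)
  assume no: "\<nexists>n. u = g n"
  have below: "lt (g n) u" for n
  proof (induction n)
    case (Suc n)
    then show ?case using g(3)[OF u(1) Suc] no by blast
  qed (rule u)
  have mono: "lt (g m) (g n)" if "m < n" for m n :: nat
    using that by (induction rule: less_Suc_induct) (auto intro: g(1,2) trans[OF g(1) g(1) g(1)])
  have "inj (\<lambda>n. g (Suc n))"
  proof (rule linorder_injI)
    fix m n :: nat assume "m < n"
    then have "lt (g (Suc m)) (g (Suc n))" using mono by simp
    then show "g (Suc m) \<noteq> g (Suc n)" using irrefl[OF g(1)[of "Suc n"]] by metis
  qed
  moreover have "range (\<lambda>n. g (Suc n)) \<subseteq> {w \<in> K. lt (g 0) w \<and> lt w u}"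
    using g(1) mono[OF zero_less_Suc] below by blast
  then have "finite (range (\<lambda>n. g (Suc n)))"
    by (rule finite_subset) (rule finite_interval[OF g(1) u(1)])
  ultimately show False
    using range_inj_infinite by blast
qed

text \<open>
  Iterate successors upwards and predecessors downwards from any element. That the two sequences
  exhaust the order is the previous lemma, applied to the order and to its dual.
\<close>
lemma order_isomorphic_int:
  assumes "K \<noteq> {}"
  obtains f :: "int \<Rightarrow> 'a" where "range f = K" "\<And>m n. lt (f m) (f n) \<longleftrightarrow> m < n"
proof -
  from \<open>K \<noteq> {}\<close> obtain z where z: "z \<in> K" by blast
  interpret dual: discrete_order K "\<lambda>x y. lt y x" by (rule dual)
  have "\<exists>s. \<forall>u\<in>K. s u \<in> K \<and> lt u (s u) \<and> (\<forall>w\<in>K. lt u w \<longrightarrow> w = s u \<or> lt (s u) w)"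
    by (rule bchoice) (use ex_cover in blast)
  then obtain s where s: "\<And>u. u \<in> K \<Longrightarrow> s u \<in> K" "\<And>u. u \<in> K \<Longrightarrow> lt u (s u)"
    "\<And>u w. u \<in> K \<Longrightarrow> w \<in> K \<Longrightarrow> lt u w \<Longrightarrow> w = s u \<or> lt (s u) w" by blast
  have "\<exists>p. \<forall>u\<in>K. p u \<in> K \<and> lt (p u) u \<and> (\<forall>w\<in>K. lt w u \<longrightarrow> w = p u \<or> lt w (p u))"
    by (rule bchoice) (use dual.ex_cover in blast)
  then obtain p where p: "\<And>u. u \<in> K \<Longrightarrow> p u \<in> K" "\<And>u. u \<in> K \<Longrightarrow> lt (p u) u"
    "\<And>u w. u \<in> K \<Longrightarrow> w \<in> K \<Longrightarrow> lt w u \<Longrightarrow> w = p u \<or> lt w (p u)" by blast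
  define up where "up n = (s ^^ n) z" for n
  define down where "down n = (p ^^ n) z" for n
  have upK: "up n \<in> K" for n by (induction n) (simp_all add: up_def z s)
  have downK: "down n \<in> K" for n by (induction n) (simp_all add: down_def z p)
  have upS: "up (Suc n) = s (up n)" and downS: "down (Suc n) = p (down n)" for n
    by (simp_all add: up_def down_def)
  define f where "f n = (if n \<ge> 0 then up (nat n) else down (nat (- n)))" for n :: int
  have fK: "f n \<in> K" for n by (simp add: f_def upK downK)
  have step: "lt (f n) (f (n + 1))" for n
  proof (cases "n \<ge> 0")
    case True
    then show ?thesis using s(2)[OF upK[of "nat n"]] by (simp add: f_def nat_add_distrib upS[symmetric])
  next
    case False
    define k where "k = nat (- n) - 1"
    have n: "n = - int k - 1" using False by (simp add: k_def)
    have "lt (down (Suc k)) (down k)" using p(2)[OF downK[of k]] by (simp add: downS)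
    moreover have "f n = down (Suc k)" using False by (simp add: f_def k_def)
    moreover have "f (n + 1) = down k"
      unfolding n by (auto simp: f_def up_def down_def)
    ultimately show ?thesis by simp
  qed
  have mono: "lt (f m) (f (m + 1 + int k))" for m k
  proof (induction k)
    case (Suc k)
    have eq: "m + 1 + int (Suc k) = (m + 1 + int k) + 1" by simp
    show ?case unfolding eq using trans[OF fK fK fK Suc step] .
  qed (simp add: step)
  have mono': "lt (f m) (f n)" if "m < n" for m n
    using mono[of m "nat (n - m - 1)"] that by simp
  have "lt (f m) (f n) \<longleftrightarrow> m < n" for m n
  proof
    assume lt: "lt (f m) (f n)"
    show "m < n"
    proof (rule ccontr)
      assume "\<not> m < n"
      then consider "n < m" | "m = n" by linarith
      then have "lt (f m) (f m)"
        using lt trans[OF fK fK fK lt mono'] by cases auto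
      then show False using irrefl fK by blast
    qed
  qed (rule mono')
  moreover have "range f = K"
  proof
    show "range f \<subseteq> K" using fK by blast
    show "K \<subseteq> range f"
    proof
      fix u assume u: "u \<in> K"
      have f_up: "f (int n) = up n" for n by (simp add: f_def)
      have f_down: "f (- int n) = down n" for n by (auto simp: f_def up_def down_def)
      consider "lt z u" | "u = z" | "lt u z" using total z u by blast
      then show "u \<in> range f"
      proof cases
        case 1
        then have "lt (up 0) u" by (simp add: up_def)
        then have "\<exists>n. u = up n"
          by (intro cover_sequence_exhausts) (use s upK u in \<open>auto simp: upS\<close>)
        then show ?thesis using f_up by (metis rangeI)
      next
        case 2
        then show ?thesis using f_up[of 0] by (metis funpow_0 rangeI up_def)
      next
        case 3
        then have "lt u (down 0)" by (simp add: down_def)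
        then have "\<exists>n. u = down n"
          by (intro dual.cover_sequence_exhausts) (use p downK u in \<open>auto simp: downS\<close>)
        then show ?thesis using f_down by (metis rangeI)
      qed
    qed
  qed
  ultimately show ?thesis using that by blast
qed

end

section \<open>Succession lines of an enumerated order\<close>

text \<open>
  Along an enumeration of the vertices in increasing order, all notions of succession become
  statements about integers: the successor adds one, and the only line from \<open>f a\<close> to \<open>f b\<close> lists the
  integers from \<open>a\<close> down to \<open>b\<close>.
\<close>
lemma enumerated_succession:
  fixes f :: "int \<Rightarrow> vertex"
  assumes verts: "range f = pverts G" and prec: "\<And>m n. precedes G (f m) (f n) \<longleftrightarrow> m < n"
  shows "unique_infinite_succession_line G"
    and "\<forall>u\<in>pverts G. \<exists>!u'. u' \<in> pverts G \<and> is_successor G u u'"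
    and "\<forall>u'\<in>pverts G. \<exists>!u. u \<in> pverts G \<and> is_predecessor G u' u"
    and "\<forall>u\<in>pverts G. predecessor (successor u G) G = u \<and> successor (predecessor u G) G = u"
    and "\<forall>u\<in>pverts G. pverts G = {successor_iterate n u G | n. True}"
proof -
  have f_eq: "f m = f n \<longleftrightarrow> m = n" for m n
    using prec[of m n] prec[of n m] prec[of n n] by (cases m n rule: linorder_cases) auto
  have mem: "f n \<in> pverts G" for n using verts by blast
  have succ: "is_successor G (f m) (f n) \<longleftrightarrow> n = m + 1" for m n
  proof -
    have "is_successor G (f m) (f n) \<longleftrightarrow> m < n \<and> \<not> (\<exists>k. m < k \<and> k < n)"
      by (simp add: is_successor_def mem verts[symmetric] prec)
    also have "\<dots> \<longleftrightarrow> n = m + 1"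
      by (auto dest: spec[of _ "m + 1"])
    finally show ?thesis .
  qed
  show 2: "\<forall>u\<in>pverts G. \<exists>!u'. u' \<in> pverts G \<and> is_successor G u u'"
  proof
    fix u assume "u \<in> pverts G"
    then obtain n where n: "u = f n" using verts by blast
    show "\<exists>!u'. u' \<in> pverts G \<and> is_successor G u u'"
      by (rule ex1I[of _ "f (n + 1)"]) (auto simp: n verts[symmetric] succ)
  qed
  show 3: "\<forall>u'\<in>pverts G. \<exists>!u. u \<in> pverts G \<and> is_predecessor G u' u"
  proof
    fix u' assume "u' \<in> pverts G"
    then obtain n where n: "u' = f n" using verts by blast
    show "\<exists>!u. u \<in> pverts G \<and> is_predecessor G u' u"
      by (rule ex1I[of _ "f (n - 1)"]) (auto simp: n is_predecessor_def verts[symmetric] succ)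
  qed
  have successor: "successor (f n) G = f (n + 1)" for n
    unfolding successor_def
  proof (rule the_equality)
    fix u assume "is_successor G (f n) u"
    moreover from this obtain m where "u = f m" using verts by (auto simp: is_successor_def)
    ultimately show "u = f (n + 1)" using succ by simp
  qed (simp add: succ)
  have predecessor: "predecessor (f n) G = f (n - 1)" for n
    unfolding predecessor_def is_predecessor_def
  proof (rule the_equality)
    fix u assume "is_successor G u (f n)"
    moreover from this obtain m where "u = f m" using verts by (auto simp: is_successor_def)
    ultimately show "u = f (n - 1)" using succ by simp
  qed (simp add: succ)
  show "\<forall>u\<in>pverts G. predecessor (successor u G) G = u \<and> successor (predecessor u G) G = u"
    by (simp add: verts[symmetric] successor predecessor)
  have "((\<lambda>w. successor w G) ^^ k) (f n) = f (n + int k)" for k n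
    by (induction k) (simp_all add: successor algebra_simps)
  moreover have "((\<lambda>w. predecessor w G) ^^ k) (f n) = f (n - int k)" for k n
    by (induction k) (simp_all add: predecessor algebra_simps)
  ultimately have iterate: "successor_iterate k (f n) G = f (n + k)" for k n
    by (simp add: successor_iterate_def)
  show "\<forall>u\<in>pverts G. pverts G = {successor_iterate n u G | n. True}"
  proof
    fix u assume "u \<in> pverts G"
    then obtain n where n: "u = f n" using verts by blast
    have "range f = range (\<lambda>k. f (n + k))"
      by (auto simp: image_iff) (metis add.commute diff_add_cancel)
    then show "pverts G = {successor_iterate n u G | n. True}"
      by (auto simp: n iterate verts[symmetric])
  qed
  define line where "line a b = map (\<lambda>i. f (a - int i)) [0..<Suc (nat (a - b))]" for a b
  have line: "succession_line G (f a) (f b) vs \<longleftrightarrow> b \<le> a \<and> vs = line a b" for a b vs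
  proof
    assume vs: "succession_line G (f a) (f b) vs"
    have entry: "i < length vs \<Longrightarrow> vs ! i = f (a - int i)" for i
    proof (induction i)
      case 0
      then show ?case using vs by (simp add: succession_line_def hd_conv_nth)
    next
      case (Suc i)
      have "is_successor G (vs ! Suc i) (vs ! i)"
        using vs Suc.prems unfolding succession_line_def by (metis diff_Suc_1 le_add1 plus_1_eq_Suc)
      moreover obtain m where m: "vs ! Suc i = f m"
        using vs Suc.prems verts nth_mem unfolding succession_line_def by blast
      ultimately have "a - int i = m + 1" using Suc succ by simp
      then show ?case unfolding m by (simp add: algebra_simps)
    qed
    have "vs \<noteq> []" "last vs = f b" using vs by (auto simp: succession_line_def)
    then have "f b = f (a - int (length vs - 1))"
      using entry[of "length vs - 1"] by (simp add: last_conv_nth)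
    then have b: "b = a - int (length vs - 1)" using f_eq by blast
    then have len: "length vs = Suc (nat (a - b))" using \<open>vs \<noteq> []\<close>
      by (cases vs) auto
    have "vs = line a b"
      unfolding line_def by (rule nth_equalityI) (simp_all add: len entry del: upt_Suc)
    with b show "b \<le> a \<and> vs = line a b" by simp
  next
    assume ab: "b \<le> a \<and> vs = line a b"
    then have vs: "vs = map (\<lambda>i. f (a - int i)) [0..<Suc (nat (a - b))]" by (simp add: line_def)
    have "vs \<noteq> []" by (simp add: vs)
    moreover have "hd vs = f a" by (simp add: vs hd_map del: upt_Suc)
    moreover have "last vs = f b" using ab by (simp add: vs)
    moreover have "set vs \<subseteq> pverts G" using mem by (auto simp: vs)
    moreover have "is_successor G (vs ! i) (vs ! (i - 1))" if "1 \<le> i" "i < length vs" for i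
      using that by (simp add: vs succ of_nat_diff del: upt_Suc)
    ultimately show "succession_line G (f a) (f b) vs"
      unfolding succession_line_def by blast
  qed
  show "unique_infinite_succession_line G"
    unfolding unique_infinite_succession_line_def
  proof (intro ballI)
    fix u v assume "u \<in> pverts G" "v \<in> pverts G"
    then obtain a b where ab: "u = f a" "v = f b" using verts by blast
    show "\<exists>!vs. succession_line G u v vs \<or> succession_line G v u vs"
      unfolding ab line by (cases a b rule: linorder_cases) auto
  qed
qed

section \<open>Depth-first order of planar forests\<close>

text \<open>
  The parity condition says that distinct vertices on one level have distance at least two. Since \<open>M\<close>
  moves a vertex by one step to a side, branches can meet but not cross.
\<close>
locale forest =
  fixes K :: "vertex set" and M :: "vertex \<Rightarrow> vertex"
  assumes even: "u \<in> K \<Longrightarrow> even (fst u + snd u)"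
    and closed: "u \<in> K \<Longrightarrow> M u \<in> K"
    and M_cases: "M u = u + (1, 1) \<or> M u = u + (-1, 1)"
begin

lemma iter_closed: "u \<in> K \<Longrightarrow> (M ^^ n) u \<in> K"
  by (induction n) (auto simp: closed)

lemma snd_M [simp]: "snd (M u) = snd u + 1"
  using M_cases[of u] by auto

lemma snd_iter [simp]: "snd ((M ^^ n) u) = snd u + int n"
  by (induction n) auto

lemma fst_iter: "\<bar>fst ((M ^^ n) u) - fst u\<bar> \<le> int n"
proof (induction n)
  case (Suc n)
  then show ?case using M_cases[of "(M ^^ n) u"] by auto
qed simp

lemma fst_M_mono:
  assumes "u \<in> K" "v \<in> K" "snd u = snd v" "fst u \<le> fst v"
  shows "fst (M u) \<le> fst (M v)"
proof (cases "u = v")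
  case False
  then have "fst u \<noteq> fst v" using assms by (auto simp: prod_eq_iff)
  moreover have "even (fst v - fst u)" using even[OF assms(1)] even[OF assms(2)] assms(3) by simp
  ultimately have "fst u + 2 \<le> fst v" using assms(4) by presburger
  then show ?thesis using M_cases[of u] M_cases[of v] by auto
qed simp

lemma fst_iter_mono:
  assumes "u \<in> K" "v \<in> K" "snd u = snd v" "fst u \<le> fst v"
  shows "fst ((M ^^ n) u) \<le> fst ((M ^^ n) v)"
proof (induction n)
  case (Suc n)
  then show ?case using fst_M_mono[of "(M ^^ n) u" "(M ^^ n) v"] assms iter_closed by simp
qed (simp add: assms)

lemma iter_eq_mono: "(M ^^ n) u = (M ^^ n) v \<Longrightarrow> n \<le> m \<Longrightarrow> (M ^^ m) u = (M ^^ m) v"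
  by (induction m) (auto simp: le_Suc_eq)

definition anc :: "vertex \<Rightarrow> int \<Rightarrow> vertex" where
  "anc u N = (M ^^ nat (N - snd u)) u"

lemma anc_self [simp]: "anc u (snd u) = u"
  by (simp add: anc_def)

lemma iter_anc: "(M ^^ n) u = anc u (snd u + int n)"
  by (simp add: anc_def)

lemma anc_anc: "snd u \<le> N \<Longrightarrow> N \<le> N' \<Longrightarrow> anc u N' = (M ^^ nat (N' - N)) (anc u N)"
  by (simp add: anc_def funpow_add[symmetric, THEN fun_cong, unfolded o_def] nat_add_distrib[symmetric])

lemma snd_anc [simp]: "snd u \<le> N \<Longrightarrow> snd (anc u N) = N"
  by (simp add: anc_def)

lemma anc_closed: "u \<in> K \<Longrightarrow> anc u N \<in> K"
  by (simp add: anc_def iter_closed)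

text \<open>
  Contraposed: once the ancestor of one vertex is strictly to the left of the ancestor of another one,
  the same was true on all lower levels that both lines visit.
\<close>
lemma fst_anc_mono:
  assumes "u \<in> K" "v \<in> K" "snd u \<le> N" "snd v \<le> N" "N \<le> N'"
    and "fst (anc u N) \<le> fst (anc v N)"
  shows "fst (anc u N') \<le> fst (anc v N')"
  using assms fst_iter_mono[of "anc u N" "anc v N"] by (simp add: anc_anc[of _ N N'] anc_closed)

text \<open>
  The depth-first order read off from positions: compare the two lines on the lowest level that both
  of them visit. A tie means that one of the vertices is an ancestor of the other, and the ancestor,
  which lies on the higher level, comes first.
\<close>
definition before :: "vertex \<Rightarrow> vertex \<Rightarrow> bool" where
  "before u v \<longleftrightarrow> (let N = max (snd u) (snd v) in
     fst (anc u N) < fst (anc v N) \<or> fst (anc u N) = fst (anc v N) \<and> snd v < snd u)"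

lemma before_irrefl: "\<not> before u u"
  by (simp add: before_def)

lemma before_total:
  assumes "u \<in> K" "v \<in> K"
  shows "before u v \<or> u = v \<or> before v u"
proof (cases "snd u = snd v")
  case True
  then have "anc u (snd v) = u" by (metis anc_self)
  with True show ?thesis by (auto simp: before_def Let_def prod_eq_iff)
qed (auto simp: before_def Let_def)

text \<open>
  The three comparisons take place on up to three different levels. They are brought to a common
  level by the monotonicity of ancestors, upwards for weak and downwards for strict inequalities.
\<close>
lemma before_trans:
  assumes K: "u \<in> K" "v \<in> K" "w \<in> K" and "before u v" "before v w"
  shows "before u w"
proof -
  define P where "P x N = fst (anc x N)" for x N
  define a b c where abc: "a = snd u" "b = snd v" "c = snd w"
  have mono: "P x N \<le> P y N \<Longrightarrow> N \<le> N' \<Longrightarrow> P x N' \<le> P y N'"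
    if "x \<in> {u, v, w}" "y \<in> {u, v, w}" "snd x \<le> N" "snd y \<le> N" for x y N N'
    unfolding P_def using fst_anc_mono[of x y N N'] that K by auto
  have uv: "P u (max a b) < P v (max a b) \<or> P u (max a b) = P v (max a b) \<and> b < a"
    and vw: "P v (max b c) < P w (max b c) \<or> P v (max b c) = P w (max b c) \<and> c < b"
    using assms(4,5) by (auto simp: before_def P_def abc Let_def)
  have "P u (max a c) < P w (max a c) \<or> P u (max a c) = P w (max a c) \<and> c < a"
  proof -
    consider "a \<le> b" "c \<le> b" | "b < a" "c \<le> a" | "b < c" "a < c" | "a = c" "b < a" by linarith
    then show ?thesis
    proof cases
      case 1
      then have "P u b < P w b" using uv vw by (auto simp: max_def split: if_splits)
      then show ?thesis using mono[of w u "max a c" b] 1 by (auto simp: abc not_le)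
    next
      case 2
      have "P v a \<le> P w a" using mono[of v w "max b c" a] vw 2 by (auto simp: abc)
      then have le: "P u a \<le> P w a" using uv 2 by auto
      show ?thesis
      proof (cases "c < a")
        case True
        then show ?thesis using le by (auto simp: max_def)
      next
        case False
        with 2 have "c = a" by simp
        with vw uv 2 show ?thesis by (auto simp: max_def)
      qed
    next
      case 3
      have "P u c \<le> P v c" using mono[of u v "max a b" c] uv 3 by (auto simp: abc)
      then show ?thesis using vw 3 by (auto simp: max_def)
    next
      case 4
      then show ?thesis using uv vw by (auto simp: max_def)
    qed
  qed
  then show ?thesis by (auto simp: before_def P_def abc Let_def)
qed

end

text \<open>
  The first assumption bounds the depth of the branch below each vertex. The second says that no vertex
  stays the right-most descendant of its ancestors for ever.
\<close>
locale coalescing_forest = forest +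
  assumes finite_depth: "v \<in> K \<Longrightarrow> \<exists>n. \<forall>u\<in>K. (M ^^ n) u \<noteq> v"
    and relative_to_right: "u \<in> K \<Longrightarrow> \<exists>n. \<exists>w\<in>K. (M ^^ n) w = (M ^^ n) u \<and> fst u < fst w"
begin

text \<open>
  Among the vertices from \<open>u\<close> on and left of \<open>v\<close> that coalesce with \<open>u\<close>, take the right-most one, \<open>x\<close>. Some
  vertex \<open>w\<close> to the right of \<open>x\<close> coalesces with \<open>x\<close>. It cannot lie left of \<open>v\<close>, so the line of \<open>v\<close> is caught
  between those of \<open>x\<close> and \<open>w\<close>.
\<close>
lemma coalesce_same_level_less:
  assumes "u \<in> K" "v \<in> K" "snd u = snd v" "fst u < fst v"
  shows "\<exists>n. (M ^^ n) u = (M ^^ n) v"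
proof (rule ccontr)
  assume no: "\<nexists>n. (M ^^ n) u = (M ^^ n) v"
  define S where "S = {w \<in> K. snd w = snd u \<and> fst u \<le> fst w \<and> fst w < fst v \<and>
    (\<exists>n. (M ^^ n) w = (M ^^ n) u)}"
  have "S \<subseteq> {fst u..fst v} \<times> {snd u}" by (auto simp: S_def)
  then have fin: "finite (fst ` S)" by (meson finite_SigmaI finite_atLeastAtMost_int finite.emptyI
      finite_imageI finite_insert finite_subset)
  have "u \<in> S" using assms by (auto simp: S_def)
  then have "Max (fst ` S) \<in> fst ` S" using fin by (intro Max_in) auto
  then obtain x where x: "x \<in> S" "fst x = Max (fst ` S)" by auto
  then have max: "fst w \<le> fst x" if "w \<in> S" for w using that fin by auto
  from x obtain m where m: "(M ^^ m) x = (M ^^ m) u" by (auto simp: S_def)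
  from relative_to_right[of x] x obtain n w
    where w: "w \<in> K" "(M ^^ n) w = (M ^^ n) x" "fst x < fst w" by (auto simp: S_def)
  have snd_w: "snd w = snd x" using arg_cong[OF w(2), of snd] by simp
  have xu: "(M ^^ max m n) x = (M ^^ max m n) u" using iter_eq_mono[OF m] by simp
  show False
  proof (cases "fst w < fst v")
    case True
    have "(M ^^ max m n) w = (M ^^ max m n) u" using iter_eq_mono[OF w(2)] xu by simp
    then have "w \<in> S" using True w x snd_w by (auto simp: S_def)
    then show False using max w(3) by fastforce
  next
    case False
    have xv: "snd x = snd v" "fst x \<le> fst v" "x \<in> K" using x assms by (auto simp: S_def)
    have "fst ((M ^^ n) x) \<le> fst ((M ^^ n) v)" "fst ((M ^^ n) v) \<le> fst ((M ^^ n) w)"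
      using fst_iter_mono[of x v n] fst_iter_mono[of v w n] xv w(1) snd_w False assms by auto
    then have "(M ^^ n) v = (M ^^ n) x" using w(2) xv by (auto simp: prod_eq_iff)
    then show False using no xu iter_eq_mono[of n v x "max m n"] by (metis max.cobounded2)
  qed
qed

lemma coalesce_same_level:
  assumes "u \<in> K" "v \<in> K" "snd u = snd v"
  shows "\<exists>n. (M ^^ n) u = (M ^^ n) v"
  using coalesce_same_level_less[of u v] coalesce_same_level_less[of v u] assms
  by (cases "fst u" "fst v" rule: linorder_cases) (metis prod_eq_iff)+

lemma common_ancestor:
  assumes "u \<in> K" "v \<in> K"
  shows "\<exists>N. snd u \<le> N \<and> snd v \<le> N \<and> anc u N = anc v N"
proof -
  let ?N = "max (snd u) (snd v)"
  obtain n where "(M ^^ n) (anc u ?N) = (M ^^ n) (anc v ?N)"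
    using coalesce_same_level[of "anc u ?N" "anc v ?N"] assms anc_closed by auto
  then have "anc u (?N + int n) = anc v (?N + int n)"
    by (subst (1 2) anc_anc[of _ ?N]) auto
  then show ?thesis by (intro exI[of _ "?N + int n"]) auto
qed

lemma finite_descendants:
  assumes "z \<in> K"
  shows "finite {w \<in> K. snd w \<le> snd z \<and> anc w (snd z) = z}"
proof -
  obtain n where n: "\<And>u. u \<in> K \<Longrightarrow> (M ^^ n) u \<noteq> z" using finite_depth[OF assms] by blast
  have "{w \<in> K. snd w \<le> snd z \<and> anc w (snd z) = z}
      \<subseteq> {fst z - int n..fst z + int n} \<times> {snd z - int n..snd z}"
  proof
    fix w assume "w \<in> {w \<in> K. snd w \<le> snd z \<and> anc w (snd z) = z}"
    then have w: "w \<in> K" "snd w \<le> snd z" "(M ^^ nat (snd z - snd w)) w = z" by (auto simp: anc_def)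
    define m where "m = nat (snd z - snd w)"
    have "m < n"
    proof (rule ccontr)
      assume "\<not> m < n"
      then have "(M ^^ n) ((M ^^ (m - n)) w) = (M ^^ m) w"
        using funpow_add[of n "m - n" M, THEN fun_cong, of w] by simp
      then show False using n[of "(M ^^ (m - n)) w"] w iter_closed by (simp add: m_def)
    qed
    moreover have "\<bar>fst z - fst w\<bar> \<le> int m" using fst_iter[of m w] w by (simp add: m_def)
    moreover have "int m = snd z - snd w" using w by (simp add: m_def)
    ultimately show "w \<in> {fst z - int n..fst z + int n} \<times> {snd z - int n..snd z}"
      using w(2) by (cases w) auto
  qed
  then show ?thesis by (rule finite_subset) simp
qed

text \<open>
  Everything between two vertices descends from their common ancestor. A vertex above the level of
  that ancestor would have to lie both on the line of \<open>v\<close> or left of it, and strictly right of the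
  line of \<open>u\<close>, although these lines are the same there.
\<close>
lemma finite_between:
  assumes "u \<in> K" "v \<in> K"
  shows "finite {w \<in> K. before u w \<and> before w v}"
proof -
  obtain N where N: "snd u \<le> N" "snd v \<le> N" "anc u N = anc v N"
    using common_ancestor[OF assms] by blast
  define z where "z = anc u N"
  have z: "z \<in> K" "snd z = N" using anc_closed assms N by (auto simp: z_def)
  have "{w \<in> K. before u w \<and> before w v} \<subseteq> {w \<in> K. snd w \<le> snd z \<and> anc w (snd z) = z}"
  proof safe
    fix x y assume xy: "(x, y) \<in> K" "before u (x, y)" "before (x, y) v"
    let ?w = "(x, y)"
    show le: "snd ?w \<le> snd z"
    proof (rule ccontr)
      assume "\<not> snd ?w \<le> snd z"
      then have less: "N < y" using z by simp
      have "anc u y = anc v y" using N less by (simp add: anc_anc[of _ N y])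
      then show False using xy less N by (auto simp: before_def Let_def)
    qed
    have "fst (anc u N) \<le> fst (anc ?w N)"
      using xy N le z fst_anc_mono[of u ?w "max (snd u) y" N] assms by (auto simp: before_def Let_def)
    moreover have "fst (anc ?w N) \<le> fst (anc v N)"
      using xy N le z fst_anc_mono[of ?w v "max y (snd v)" N] assms by (auto simp: before_def Let_def)
    ultimately have "fst (anc ?w N) = fst z" using N by (simp add: z_def)
    then show "anc ?w (snd z) = z" using le z by (simp add: prod_eq_iff)
  qed
  then show ?thesis using finite_descendants[OF z(1)] by (rule finite_subset)
qed

lemma no_first: "u \<in> K \<Longrightarrow> \<exists>v\<in>K. before v u"
  by (rule bexI[of _ "M u"]) (auto simp: before_def Let_def anc_def closed)

lemma no_last:
  assumes "u \<in> K"
  shows "\<exists>v\<in>K. before u v"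
proof -
  obtain n w where w: "w \<in> K" "(M ^^ n) w = (M ^^ n) u" "fst u < fst w"
    using relative_to_right[OF assms] by blast
  have "snd w = snd u" using arg_cong[OF w(2), of snd] by simp
  then have "before u w" using w by (simp add: before_def anc_def)
  with w show ?thesis by blast
qed

text \<open>
  The levels of \<open>u\<close> and \<open>v\<close> fix the difference of the two exponents, so both are minimal at the same
  time.
\<close>
lemma closest_common_ancestor_ex:
  assumes uv: "u \<in> K" "v \<in> K"
  obtains i j where "(M ^^ i) u = (M ^^ j) v"
    "\<And>i' j'. (M ^^ i') u = (M ^^ j') v \<Longrightarrow> i \<le> i' \<and> j \<le> j'"
proof -
  have "\<exists>i j. (M ^^ i) u = (M ^^ j) v"
    using common_ancestor[OF uv] by (auto simp: anc_def)
  define i where "i = (LEAST i. \<exists>j. (M ^^ i) u = (M ^^ j) v)"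
  obtain j where j: "(M ^^ i) u = (M ^^ j) v"
    using LeastI_ex[OF \<open>\<exists>i j. (M ^^ i) u = (M ^^ j) v\<close>] unfolding i_def by blast
  have "i \<le> i' \<and> j \<le> j'" if eq: "(M ^^ i') u = (M ^^ j') v" for i' j'
  proof -
    have "i \<le> i'" unfolding i_def using eq by (intro Least_le) blast
    moreover have "snd u + int i = snd v + int j" "snd u + int i' = snd v + int j'"
      using arg_cong[OF j, of snd] arg_cong[OF eq, of snd] by simp_all
    ultimately show ?thesis by linarith
  qed
  with j that show thesis by blast
qed

context
  fixes G :: "vertex pair_pre_digraph"
  assumes verts: "pverts G = K" and arcs: "parcs G = {(u, M u) | u. u \<in> K}"
begin

lemma mother_eq: "u \<in> K \<Longrightarrow> mother G u = M u"
  unfolding mother_def arcs by (rule the_equality) blast+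

lemma mother_iter: "u \<in> K \<Longrightarrow> (mother G ^^ n) u = (M ^^ n) u"
  by (induction n) (auto simp: mother_eq iter_closed)

text \<open>
  Of two sisters the older one is on the left, and only she climbs to the right.
\<close>
lemma sigma_less_iff:
  assumes ab: "a \<in> K" "b \<in> K" "a \<noteq> b" "M a = M b"
  shows "sigma G a < sigma G b \<longleftrightarrow> fst a < fst b"
proof -
  have "sisters G a b" "sisters G b a"
    using ab closed by (auto simp: sisters_def daughters_def verts mother_eq)
  then have "\<exists>v. sisters G a v" "\<exists>v. sisters G b v" by blast+
  then have "is_older_sister G a \<longleftrightarrow> M a = a + (1, 1)" "is_older_sister G b \<longleftrightarrow> M b = b + (1, 1)"
    unfolding is_older_sister_def using ab by (auto simp only: mother_eq) (auto simp: prod_eq_iff)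
  moreover have "(M a = a + (1, 1) \<and> M b = b + (-1, 1)) \<or> (M a = a + (-1, 1) \<and> M b = b + (1, 1))"
    using M_cases[of a] M_cases[of b] ab by auto
  ultimately show ?thesis using ab(4) by (auto simp: sigma_def prod_eq_iff)
qed

text \<open>
  If neither vertex is an ancestor of the other, the lines arrive at the closest common ancestor
  through two sisters. The order of the sisters is the order of the lines on all levels below, as
  lines cannot cross.
\<close>
lemma precedes_iff_before:
  assumes uv: "u \<in> K" "v \<in> K"
  shows "precedes G u v \<longleftrightarrow> before u v"
proof -
  obtain i j where ij: "(M ^^ i) u = (M ^^ j) v"
    and min: "\<And>i' j'. (M ^^ i') u = (M ^^ j') v \<Longrightarrow> i \<le> i' \<and> j \<le> j'"
    using closest_common_ancestor_ex[OF uv] by blast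
  have cca: "closest_common_ancestor G u v i' j' \<longleftrightarrow> i' = i \<and> j' = j" for i' j'
    unfolding closest_common_ancestor_def mother_iter[OF uv(1)] mother_iter[OF uv(2)]
    using ij min by (metis le_antisym)
  have prec: "precedes G u v \<longleftrightarrow> sigma_at G (int i - 1) u < sigma_at G (int j - 1) v"
    by (auto simp: precedes_def cca verts uv)
  have pos: "0 < sigma G x" for x by (simp add: sigma_def)
  have lev: "snd u + int i = snd v + int j" using arg_cong[OF ij, of snd] by simp
  show ?thesis
  proof (cases "i = 0 \<or> j = 0")
    case True
    then show ?thesis
    proof
      assume i: "i = 0"
      then have "anc v (snd u) = u" using ij lev by (simp add: iter_anc)
      moreover have "j > 0 \<longleftrightarrow> snd v < snd u" "snd v \<le> snd u" using lev i by auto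
      moreover have "\<not> before u v" if "j = 0" using ij i that before_irrefl by simp
      ultimately show ?thesis
        unfolding prec using pos i by (cases "j = 0") (simp_all add: before_def sigma_at_def)
    next
      assume j: "j = 0"
      then have "anc u (snd v) = v" using ij lev by (simp add: iter_anc)
      moreover have "snd u \<le> snd v" using lev j by simp
      ultimately show ?thesis
        using j by (simp add: prec before_def sigma_at_def max_absorb2)
    qed
  next
    case False
    define a b where "a = (M ^^ (i - 1)) u" and "b = (M ^^ (j - 1)) v"
    have "a \<noteq> b" using min[of "i - 1" "j - 1"] False by (auto simp: a_def b_def)
    have "M a = (M ^^ i) u" "M b = (M ^^ j) v"
      using False funpow_add[of 1 "i - 1" M, THEN fun_cong, of u]
        funpow_add[of 1 "j - 1" M, THEN fun_cong, of v]
      by (simp_all add: a_def b_def)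
    with ij have "M a = M b" by simp
    have aK: "a \<in> K" "b \<in> K" using uv iter_closed by (auto simp: a_def b_def)
    have "precedes G u v \<longleftrightarrow> sigma G a < sigma G b"
      using False by (auto simp: prec sigma_at_def mother_iter uv a_def b_def nat_diff_distrib)
    also have "\<dots> \<longleftrightarrow> fst a < fst b"
      using sigma_less_iff aK \<open>a \<noteq> b\<close> \<open>M a = M b\<close> by blast
    finally have prec_ab: "precedes G u v \<longleftrightarrow> fst a < fst b" .
    define L where "L = snd u + int i - 1"
    have L: "a = anc u L" "b = anc v L" "snd u \<le> L" "snd v \<le> L"
      using False lev by (auto simp: a_def b_def iter_anc L_def of_nat_diff algebra_simps)
    have "snd a = snd b" using L by simp
    with \<open>a \<noteq> b\<close> have ne: "fst a \<noteq> fst b" by (auto simp: prod_eq_iff)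
    let ?N = "max (snd u) (snd v)"
    have "fst (anc u ?N) \<le> fst (anc v ?N) \<Longrightarrow> fst a \<le> fst b"
      "fst (anc v ?N) \<le> fst (anc u ?N) \<Longrightarrow> fst b \<le> fst a"
      using fst_anc_mono[of u v ?N L] fst_anc_mono[of v u ?N L] uv L by simp_all
    with ne have "fst a < fst b \<longleftrightarrow> fst (anc u ?N) < fst (anc v ?N)"
      "fst (anc u ?N) \<noteq> fst (anc v ?N)" by linarith+
    then show ?thesis by (auto simp: prec_ab before_def)
  qed
qed

lemma discrete_order_before: "discrete_order K before"
proof
  fix x y z assume "x \<in> K" "y \<in> K" "z \<in> K" "before x y" "before y z"
  then show "before x z" by (rule before_trans)
qed (simp_all add: before_irrefl before_total finite_between no_last no_first)

lemma enumeration: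
  assumes "K \<noteq> {}"
  obtains f where "range f = pverts G" "\<And>m n :: int. precedes G (f m) (f n) \<longleftrightarrow> m < n"
proof -
  obtain f :: "int \<Rightarrow> vertex" where f: "range f = K" "\<And>m n. before (f m) (f n) \<longleftrightarrow> m < n"
    using discrete_order.order_isomorphic_int[OF discrete_order_before assms] by blast
  have "f m \<in> K" for m using f(1) by blast
  then have "precedes G (f m) (f n) \<longleftrightarrow> m < n" for m n
    using f(2) precedes_iff_before by blast
  with that f(1) verts show thesis by blast
qed

end

end

section \<open>Right-most paths are greedy\<close>

definition up_right :: "vertex \<Rightarrow> vertex" where "up_right u = u + (1, 1)"
definition up_left :: "vertex \<Rightarrow> vertex" where "up_left u = u + (-1, 1)"

lemma up_right_simps [simp]: "fst (up_right u) = fst u + 1" "snd (up_right u) = snd u + 1"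
  and up_left_simps [simp]: "fst (up_left u) = fst u - 1" "snd (up_left u) = snd u + 1"
  by (simp_all add: up_right_def up_left_def)

lemma up_right_neq_up_left [simp]: "up_right u \<noteq> up_left u" "up_left u \<noteq> up_right u"
  by (auto simp: prod_eq_iff)

lemma lattice_iff: "u \<in> lattice \<longleftrightarrow> even (fst u + snd u)"
  by (cases u) (simp add: lattice_def)

lemma up_right_lattice_iff [simp]: "up_right u \<in> lattice \<longleftrightarrow> u \<in> lattice"
  and up_left_lattice_iff [simp]: "up_left u \<in> lattice \<longleftrightarrow> u \<in> lattice"
  by (simp_all add: lattice_iff)

lemma lattice_edges_iff: "(u, v) \<in> lattice_edges \<longleftrightarrow> u \<in> lattice \<and> (v = up_right u \<or> v = up_left u)"
  by (cases u; cases v) (auto simp: lattice_edges_def up_right_def up_left_def)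

lemma open_edgesD: "(u, v) \<in> open_edges \<omega> \<Longrightarrow> u \<in> lattice \<and> (v = up_right u \<or> v = up_left u)"
  by (simp add: open_edges_def lattice_edges_iff)

text \<open>
  Percolation is the decreasing limit of these events, each of which depends on finitely many edges.
  They carry the compactness argument below as well as measurability.
\<close>
fun survives :: "config \<Rightarrow> nat \<Rightarrow> vertex \<Rightarrow> bool" where
  "survives \<omega> 0 u \<longleftrightarrow> True"
| "survives \<omega> (Suc n) u \<longleftrightarrow>
     (u, up_right u) \<in> open_edges \<omega> \<and> survives \<omega> n (up_right u) \<or>
     (u, up_left u) \<in> open_edges \<omega> \<and> survives \<omega> n (up_left u)"

lemma survives_Suc_iff: "survives \<omega> (Suc n) u \<longleftrightarrow> (\<exists>v. (u, v) \<in> open_edges \<omega> \<and> survives \<omega> n v)"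
  unfolding survives.simps using open_edgesD by blast

lemma survives_antimono: "survives \<omega> n u \<Longrightarrow> m \<le> n \<Longrightarrow> survives \<omega> m u"
proof (induction n arbitrary: m u)
  case (Suc n)
  show ?case
  proof (cases m)
    case (Suc k)
    with Suc.prems Suc.IH show ?thesis unfolding Suc survives_Suc_iff by (meson Suc_le_mono)
  qed simp
qed simp

lemma path_survives:
  assumes "(u, v) \<in> (open_edges \<omega>)\<^sup>*"
  shows "\<exists>m. snd v = snd u + int m \<and> \<bar>fst v - fst u\<bar> \<le> int m \<and> survives \<omega> m u"
  using assms
proof (induction rule: converse_rtrancl_induct)
  case base
  then show ?case by (intro exI[of _ 0]) simp
next
  case (step u w)
  then obtain m where m: "snd v = snd w + int m" "\<bar>fst v - fst w\<bar> \<le> int m" "survives \<omega> m w" by blast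
  show ?case
    using open_edgesD[OF step(1)] m step(1) by (intro exI[of _ "Suc m"]) auto
qed

lemma survives_path:
  assumes "u \<in> lattice" "survives \<omega> n u"
  shows "\<exists>v\<in>lattice. (u, v) \<in> (open_edges \<omega>)\<^sup>* \<and> snd v = snd u + int n"
  using assms
proof (induction n arbitrary: u)
  case (Suc n)
  then obtain w where w: "(u, w) \<in> open_edges \<omega>" "survives \<omega> n w" unfolding survives_Suc_iff by blast
  have uw: "w \<in> lattice" "snd w = snd u + 1" using open_edgesD[OF w(1)] by auto
  obtain v where "v \<in> lattice" "(w, v) \<in> (open_edges \<omega>)\<^sup>*" "snd v = snd w + int n"
    using Suc.IH[OF uw(1) w(2)] by blast
  then show ?case using w(1) uw(2) by (intro bexI[of _ v]) (auto intro: converse_rtrancl_into_rtrancl)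
qed auto

text \<open>
  A cluster is finite exactly if it is bounded in height, because each level meets it in a finite set.
\<close>
lemma percolation_points_iff: "u \<in> percolation_points \<omega> \<longleftrightarrow> u \<in> lattice \<and> (\<forall>n. survives \<omega> n u)"
proof (intro iffI conjI allI)
  assume "u \<in> percolation_points \<omega>"
  then have u: "u \<in> lattice" "infinite (cluster \<omega> u)" by (auto simp: percolation_points_def)
  show "u \<in> lattice" by fact
  fix n
  show "survives \<omega> n u"
  proof (rule ccontr)
    assume n: "\<not> survives \<omega> n u"
    have "cluster \<omega> u \<subseteq> {fst u - int n..fst u + int n} \<times> {snd u..snd u + int n}"
    proof
      fix v assume "v \<in> cluster \<omega> u"
      then obtain m where m: "snd v = snd u + int m" "\<bar>fst v - fst u\<bar> \<le> int m" "survives \<omega> m u"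
        using path_survives unfolding cluster_def connects_def by blast
      have "m < n" using survives_antimono[OF m(3)] n by (meson not_le)
      with m show "v \<in> {fst u - int n..fst u + int n} \<times> {snd u..snd u + int n}"
        by (cases v) auto
    qed
    then show False using u(2) finite_subset by blast
  qed
next
  assume u: "u \<in> lattice \<and> (\<forall>n. survives \<omega> n u)"
  have "range (\<lambda>n. snd u + int n) \<subseteq> snd ` cluster \<omega> u"
  proof safe
    fix n
    obtain v where "v \<in> lattice" "(u, v) \<in> (open_edges \<omega>)\<^sup>*" "snd v = snd u + int n"
      using survives_path u by blast
    then show "snd u + int n \<in> snd ` cluster \<omega> u"
      using u by (intro image_eqI[of _ _ v]) (auto simp: cluster_def connects_def)
  qed
  moreover have "infinite (range (\<lambda>n. snd u + int n))"
    by (intro range_inj_infinite injI) simp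
  ultimately have "infinite (cluster \<omega> u)"
    using finite_subset by blast
  with u show "u \<in> percolation_points \<omega>" by (simp add: percolation_points_def)
qed

text \<open>
  The compactness argument: if neither edge leads to a percolation point, both branches die out within
  a common finite height.
\<close>
lemma percolation_points_step_iff:
  "u \<in> percolation_points \<omega> \<longleftrightarrow>
     (u, up_right u) \<in> open_edges \<omega> \<and> up_right u \<in> percolation_points \<omega> \<or>
     (u, up_left u) \<in> open_edges \<omega> \<and> up_left u \<in> percolation_points \<omega>" (is "?L \<longleftrightarrow> ?R")
proof
  assume u: ?L
  show ?R
  proof (rule ccontr)
    assume not: "\<not> ?R"
    have lat: "u \<in> lattice" using u by (simp add: percolation_points_iff)
    obtain m where m: "(u, up_right u) \<in> open_edges \<omega> \<Longrightarrow> \<not> survives \<omega> m (up_right u)"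
      using not lat by (auto simp: percolation_points_iff)
    obtain n where n: "(u, up_left u) \<in> open_edges \<omega> \<Longrightarrow> \<not> survives \<omega> n (up_left u)"
      using not lat by (auto simp: percolation_points_iff)
    have "survives \<omega> (Suc (max m n)) u" using u percolation_points_iff by blast
    then show False
      using m n survives_antimono[of \<omega> "max m n" "up_right u" m] survives_antimono[of \<omega> "max m n" "up_left u" n]
      by auto
  qed
next
  assume R: ?R
  then have "u \<in> lattice" using open_edgesD by blast
  moreover have "survives \<omega> n u" for n
    using R by (cases n) (auto simp: percolation_points_iff)
  ultimately show ?L by (simp add: percolation_points_iff)
qed

lemma percolation_points_lattice: "u \<in> percolation_points \<omega> \<Longrightarrow> u \<in> lattice"
  by (simp add: percolation_points_iff)

lemma percolation_points_edge:
  "(u, v) \<in> open_edges \<omega> \<Longrightarrow> v \<in> percolation_points \<omega> \<Longrightarrow> u \<in> percolation_points \<omega>"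
  using open_edgesD percolation_points_step_iff by blast

text \<open>
  The greedy rule. On percolation points this turns out to be the mother in the right-most graph.
\<close>
definition step :: "config \<Rightarrow> vertex \<Rightarrow> vertex" where
  "step \<omega> u = (if (u, up_right u) \<in> open_edges \<omega> \<and> up_right u \<in> percolation_points \<omega> then up_right u else up_left u)"

lemma step_edge: "u \<in> percolation_points \<omega> \<Longrightarrow> (u, step \<omega> u) \<in> open_edges \<omega>"
  and step_closed: "u \<in> percolation_points \<omega> \<Longrightarrow> step \<omega> u \<in> percolation_points \<omega>"
  using percolation_points_step_iff[of u \<omega>] by (auto simp: step_def)

lemma step_greedy:
  "(u, v) \<in> open_edges \<omega> \<Longrightarrow> v \<in> percolation_points \<omega> \<Longrightarrow> fst v \<le> fst (step \<omega> u)"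
  using open_edgesD[of u v \<omega>] by (auto simp: step_def)

interpretation perc: forest "percolation_points \<omega>" "step \<omega>" for \<omega>
proof
  fix u
  show "u \<in> percolation_points \<omega> \<Longrightarrow> even (fst u + snd u)"
    using percolation_points_lattice lattice_iff by blast
  show "step \<omega> u = u + (1, 1) \<or> step \<omega> u = u + (-1, 1)"
    by (simp add: step_def up_right_def up_left_def)
qed (rule step_closed)

lemma infinite_path_percolates:
  assumes "\<And>n. (v n, v (Suc n)) \<in> open_edges \<omega>"
  shows "v n \<in> percolation_points \<omega>"
proof -
  have "survives \<omega> m (v n)" for m
  proof (induction m arbitrary: n)
    case (Suc m)
    then show ?case unfolding survives_Suc_iff using assms by blast
  qed simp
  then show ?thesis using open_edgesD[OF assms] by (auto simp: percolation_points_iff)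
qed

text \<open>
  An open path from \<open>u\<close> to a percolation point runs through percolation points, and it never passes the
  greedy path on the right: where the two meet, the greedy path moves as far right as possible.
\<close>
lemma greedy_path_bounds:
  assumes "(u, w) \<in> (open_edges \<omega>)\<^sup>*" "w \<in> percolation_points \<omega>"
  shows "fst w \<le> fst ((step \<omega> ^^ nat (snd w - snd u)) u)"
proof -
  have "snd u \<le> snd w \<and> (w \<in> percolation_points \<omega> \<longrightarrow>
    u \<in> percolation_points \<omega> \<and> fst w \<le> fst ((step \<omega> ^^ nat (snd w - snd u)) u))"
    using assms(1)
  proof (induction rule: rtrancl_induct)
    case (step x w)
    have w: "snd w = snd x + 1" using open_edgesD[OF step(2)] by auto
    define s where "s = (step \<omega> ^^ nat (snd x - snd u)) u"
    have "nat (snd w - snd u) = Suc (nat (snd x - snd u))"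
      using w step.IH Suc_nat_eq_nat_zadd1[of "snd x - snd u"] by (simp add: algebra_simps)
    then have s: "(step \<omega> ^^ nat (snd w - snd u)) u = step \<omega> s" by (simp add: s_def)
    have snd_s: "snd s = snd x" using step.IH by (simp add: s_def)
    have "u \<in> percolation_points \<omega> \<and> fst w \<le> fst (step \<omega> s)" if wK: "w \<in> percolation_points \<omega>"
    proof -
      have xK: "x \<in> percolation_points \<omega>" using step(2) wK by (rule percolation_points_edge)
      then have uK: "u \<in> percolation_points \<omega>" and xs: "fst x \<le> fst s"
        using step.IH by (auto simp: s_def)
      have "s \<in> percolation_points \<omega>" unfolding s_def using uK by (rule perc.iter_closed)
      then have "fst (step \<omega> x) \<le> fst (step \<omega> s)"
        using perc.fst_M_mono[of x \<omega> s] xK xs snd_s by simp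
      with uK step_greedy[OF step(2) wK] show ?thesis by simp
    qed
    then show ?case using step.IH w s by simp
  qed simp
  then show ?thesis using assms(2) by blast
qed

text \<open>
  A path that moves left where the greedy rule moves right has the vertex that it missed two units to
  its right, and this vertex is a reachable percolation point.
\<close>
lemma rightmost_path_iff:
  assumes u: "u \<in> percolation_points \<omega>"
  shows "rightmost_path \<omega> u v \<longleftrightarrow> v = (\<lambda>n. (step \<omega> ^^ n) u)"
proof
  assume v: "rightmost_path \<omega> u v"
  have "(v (Suc n - 1), v (Suc n)) \<in> open_edges \<omega>" for n
    using v unfolding rightmost_path_def by (metis le_add1 plus_1_eq_Suc)
  then have edge: "(v n, v (Suc n)) \<in> open_edges \<omega>" for n by simp
  have vK: "v n \<in> percolation_points \<omega>" for n using infinite_path_percolates edge .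
  have reach: "(v 0, v n) \<in> (open_edges \<omega>)\<^sup>*" for n
    by (induction n) (auto intro: rtrancl_into_rtrancl edge)
  have "v n = (step \<omega> ^^ n) u" for n
  proof (induction n)
    case 0
    then show ?case using v by (simp add: rightmost_path_def)
  next
    case (Suc n)
    have "v (Suc n) = step \<omega> (v n)"
    proof (rule ccontr)
      assume ne: "v (Suc n) \<noteq> step \<omega> (v n)"
      have "v (Suc n) = up_right (v n) \<or> v (Suc n) = up_left (v n)" using open_edgesD[OF edge] by blast
      with ne have up_left: "v (Suc n) = up_left (v n)" and up_right: "step \<omega> (v n) = up_right (v n)"
        using edge[of n] vK[of "Suc n"] by (auto simp: step_def split: if_splits)
      have shift: "up_right (v n) = (fst (v (Suc n)) + 2, snd (v (Suc n)))"
        by (simp add: up_left prod_eq_iff)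
      have "up_right (v n) \<in> percolation_points \<omega>" "(v n, up_right (v n)) \<in> open_edges \<omega>"
        using step_closed[OF vK, of n] step_edge[OF vK, of n] by (simp_all add: up_right)
      moreover from this have "(u, up_right (v n)) \<in> (open_edges \<omega>)\<^sup>*"
        using v reach[of n] by (auto simp: rightmost_path_def intro: rtrancl_into_rtrancl)
      then have "connects \<omega> u (up_right (v n))"
        using u percolation_points_lattice[OF vK, of n]
        by (simp add: connects_def percolation_points_lattice)
      ultimately have "\<exists>k::int. k \<ge> 1 \<and> connects \<omega> u (fst (v (Suc n)) + k, snd (v (Suc n))) \<and>
          (fst (v (Suc n)) + k, snd (v (Suc n))) \<in> percolation_points \<omega>"
        unfolding shift by (intro exI[of _ 2]) simp
      then show False
        using v unfolding rightmost_path_def by (metis le_add1 plus_1_eq_Suc)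
    qed
    then show ?case using Suc by simp
  qed
  then show "v = (\<lambda>n. (step \<omega> ^^ n) u)" by blast
next
  assume v: "v = (\<lambda>n. (step \<omega> ^^ n) u)"
  have "(v (n - 1), v n) \<in> open_edges \<omega>" if "n \<ge> 1" for n
    using step_edge[OF perc.iter_closed[OF u, of "n - 1"]] that by (cases n) (simp_all add: v)
  moreover have False if "k \<ge> 1" "connects \<omega> u (fst (v n) + k, snd (v n))"
    "(fst (v n) + k, snd (v n)) \<in> percolation_points \<omega>" for n and k :: int
    using greedy_path_bounds[of u "(fst (v n) + k, snd (v n))" \<omega>] that
    by (simp add: connects_def v)
  ultimately show "rightmost_path \<omega> u v"
    unfolding rightmost_path_def by (auto simp: v)
qed

lemma gamma_eq: "u \<in> percolation_points \<omega> \<Longrightarrow> gamma \<omega> u n = (step \<omega> ^^ n) u"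
  unfolding gamma_def by (subst the_equality[of _ "\<lambda>n. (step \<omega> ^^ n) u"]) (auto simp: rightmost_path_iff)

lemma rightmost_graph_arcs: "parcs (rightmost_graph \<omega>) = {(u, step \<omega> u) | u. u \<in> percolation_points \<omega>}"
proof (intro equalityI subsetI)
  fix e assume "e \<in> parcs (rightmost_graph \<omega>)"
  then obtain u n where u: "u \<in> percolation_points \<omega>" "e = (gamma \<omega> u n, gamma \<omega> u (Suc n))"
    unfolding rightmost_graph_def by auto
  then have "e = ((step \<omega> ^^ n) u, step \<omega> ((step \<omega> ^^ n) u))" by (simp add: gamma_eq)
  then show "e \<in> {(u, step \<omega> u) | u. u \<in> percolation_points \<omega>}"
    using perc.iter_closed[OF u(1)] by blast
next
  fix e assume "e \<in> {(u, step \<omega> u) | u. u \<in> percolation_points \<omega>}"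
  then obtain u where u: "u \<in> percolation_points \<omega>" "e = (u, step \<omega> u)" by blast
  then have "e = (gamma \<omega> u 0, gamma \<omega> u (Suc 0))" by (simp add: gamma_eq)
  with u(1) show "e \<in> parcs (rightmost_graph \<omega>)" unfolding rightmost_graph_def
    by (simp only: pair_pre_digraph.simps) blast
qed

lemma rightmost_graph_verts: "pverts (rightmost_graph \<omega>) = percolation_points \<omega>"
  by (simp add: rightmost_graph_def)

definition has_descendant :: "config \<Rightarrow> nat \<Rightarrow> vertex \<Rightarrow> bool" where
  "has_descendant \<omega> n v \<longleftrightarrow> (\<exists>u\<in>percolation_points \<omega>. (step \<omega> ^^ n) u = v)"

text \<open>
  Ancient vertices are those through which a bi-infinite line of the graph passes.
\<close>
definition ancient :: "config \<Rightarrow> vertex \<Rightarrow> bool" where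
  "ancient \<omega> v \<longleftrightarrow> (\<forall>n. has_descendant \<omega> n v)"

definition rightmost_descendant :: "config \<Rightarrow> nat \<Rightarrow> vertex \<Rightarrow> bool" where
  "rightmost_descendant \<omega> n u \<longleftrightarrow> u \<in> percolation_points \<omega> \<and>
     (\<forall>w\<in>percolation_points \<omega>. (step \<omega> ^^ n) w = (step \<omega> ^^ n) u \<longrightarrow> fst w \<le> fst u)"

text \<open>
  Since no vertex is permanently right-most, branches coalesce and the order has no last element; since no
  vertex is ancient, branches are finite.
\<close>
lemma succession_structure:
  fixes \<omega>
  defines "G \<equiv> rightmost_graph \<omega>" and "K \<equiv> percolation_points \<omega>"
  assumes not_ancient: "\<And>v. v \<in> K \<Longrightarrow> \<not> ancient \<omega> v"
    and not_rightmost: "\<And>u. u \<in> K \<Longrightarrow> \<exists>n. \<not> rightmost_descendant \<omega> n u"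
  shows "unique_infinite_succession_line G \<and>
      (\<forall>u\<in>K. \<exists>!u'. u' \<in> K \<and> is_successor G u u') \<and>
      (\<forall>u'\<in>K. \<exists>!u. u \<in> K \<and> is_predecessor G u' u) \<and>
      (\<forall>u\<in>K. predecessor (successor u G) G = u \<and> successor (predecessor u G) G = u) \<and>
      (\<forall>u\<in>K. K = {successor_iterate n u G | n :: int. True})"
proof (cases "K = {}")
  case True
  then have "pverts G = {}" by (simp add: G_def K_def rightmost_graph_verts)
  with True show ?thesis by (simp add: unique_infinite_succession_line_def)
next
  case False
  interpret coalescing_forest K "step \<omega>"
    unfolding K_def
  proof (rule coalescing_forest.intro[OF perc.forest_axioms], rule coalescing_forest_axioms.intro)
    fix v assume v: "v \<in> percolation_points \<omega>"
    then show "\<exists>n. \<forall>u\<in>percolation_points \<omega>. (step \<omega> ^^ n) u \<noteq> v"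
      using not_ancient unfolding K_def ancient_def has_descendant_def by blast
    show "\<exists>n. \<exists>w\<in>percolation_points \<omega>. (step \<omega> ^^ n) w = (step \<omega> ^^ n) v \<and> fst v < fst w"
      using not_rightmost[of v] v unfolding K_def rightmost_descendant_def not_le[symmetric] by blast
  qed
  have verts: "pverts G = K" by (simp add: G_def K_def rightmost_graph_verts)
  have arcs: "parcs G = {(u, step \<omega> u) | u. u \<in> K}"
    by (simp add: G_def K_def rightmost_graph_arcs)
  obtain f where f: "range f = pverts G" "\<And>m n :: int. precedes G (f m) (f n) \<longleftrightarrow> m < n"
    using enumeration[OF verts arcs False] by blast
  show ?thesis
    using enumerated_succession[OF f, unfolded verts] by (intro conjI)
qed

section \<open>Merging ancient lines by a finite modification\<close>

lemma has_descendant_Suc_iff: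
  "has_descendant \<omega> (Suc n) v \<longleftrightarrow> (\<exists>d. step \<omega> d = v \<and> has_descendant \<omega> n d)"
  unfolding has_descendant_def funpow.simps o_def by blast

lemma has_descendant_antimono: "has_descendant \<omega> n v \<Longrightarrow> m \<le> n \<Longrightarrow> has_descendant \<omega> m v"
proof (induction n)
  case (Suc n)
  have "has_descendant \<omega> n v"
    using Suc.prems(1) step_closed unfolding has_descendant_def funpow_Suc_right o_def by blast
  with Suc show ?case by (cases "m = Suc n") auto
qed simp

lemma ancient_percolates: "ancient \<omega> v \<Longrightarrow> v \<in> percolation_points \<omega>"
  unfolding ancient_def has_descendant_def by (metis funpow_0)

lemma ancient_step: "ancient \<omega> v \<Longrightarrow> ancient \<omega> (step \<omega> v)"
  using has_descendant_Suc_iff has_descendant_antimono unfolding ancient_def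
  by (metis le_SucI order_refl)

text \<open>
  A vertex has at most two daughters. If each of them lacked descendants in some generation, then so
  would the mother.
\<close>
lemma ancient_daughter:
  assumes "ancient \<omega> v"
  shows "\<exists>d. step \<omega> d = v \<and> ancient \<omega> d"
proof (rule ccontr)
  define a b where "a = v + (-1, -1)" and "b = v + (1, -1)"
  have daughters: "d = a \<or> d = b" if "step \<omega> d = v" for d
    using that by (auto simp: step_def a_def b_def prod_eq_iff split: if_splits)
  assume "\<nexists>d. step \<omega> d = v \<and> ancient \<omega> d"
  then obtain m n where m: "step \<omega> a = v \<Longrightarrow> \<not> has_descendant \<omega> m a"
    and n: "step \<omega> b = v \<Longrightarrow> \<not> has_descendant \<omega> n b"
    unfolding ancient_def by metis
  have "has_descendant \<omega> (Suc (max m n)) v" using assms unfolding ancient_def by blast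
  then obtain d where d: "step \<omega> d = v" "has_descendant \<omega> (max m n) d"
    unfolding has_descendant_Suc_iff by blast
  then have "has_descendant \<omega> m d" "has_descendant \<omega> n d"
    using has_descendant_antimono by fastforce+
  with d(1) daughters m n show False by blast
qed

text \<open>
  Where the minimum is attained, the sequence cannot decrease any more.
\<close>
lemma descent_eventually_constant:
  fixes g :: "nat \<Rightarrow> int"
  assumes "\<And>n. g n \<ge> 0" and "\<And>n. g (Suc n) \<le> g n"
  shows "\<exists>m. \<forall>n\<ge>m. g n = g m"
proof -
  obtain m where m: "\<And>n. nat (g m) \<le> nat (g n)"
    using ex_has_least_nat[of "\<lambda>_. True" 0 "\<lambda>n. nat (g n)"] by auto
  have "g n = g m" if "n \<ge> m" for n
  proof (rule antisym)
    show "g n \<le> g m" using assms(2) that by (rule lift_Suc_antimono_le)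
    show "g m \<le> g n" using m[of n] assms(1)[of n] by simp
  qed
  then show ?thesis by blast
qed

definition never_merges :: "config \<Rightarrow> bool" where
  "never_merges \<omega> \<longleftrightarrow>
     (\<forall>a b. ancient \<omega> a \<longrightarrow> ancient \<omega> b \<longrightarrow> step \<omega> a = step \<omega> b \<longrightarrow> a = b)"

lemma never_merges_iter:
  assumes "never_merges \<omega>" "ancient \<omega> a" "ancient \<omega> b" "(step \<omega> ^^ n) a = (step \<omega> ^^ n) b"
  shows "a = b"
  using assms(2-)
proof (induction n arbitrary: a b)
  case (Suc n)
  then have "step \<omega> a = step \<omega> b" by (simp add: funpow_swap1 ancient_step)
  then show ?case using Suc.prems assms(1) unfolding never_merges_def by blast
qed simp

text \<open>
  Let the straight line that climbs to the right from \<open>x\<close> hit the path of \<open>y\<close> for the first time at height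
  \<open>h\<close>; it does, as otherwise the path of \<open>y\<close> would end in an infinite open ray to the right. Open
  the segment up to that point, so that the path from \<open>x\<close> follows it and joins the path from \<open>y\<close>. Opening
  edges may create percolation points below the segment and divert the lines of descent into \<open>x\<close> and
  \<open>y\<close>. This is why the remaining edges into the interior of the segment are closed: then the segment can
  only be entered through \<open>x\<close>, which percolated before, and up to height \<open>h\<close> the only new percolation
  points are the interior points of the segment. The closed edges start on the level of \<open>x\<close> or above it
  and end strictly to the left of the path of \<open>y\<close>, so that neither this path nor a line of descent into
  \<open>x\<close> or \<open>y\<close> loses an edge.
\<close>
lemma merging_modification:
  assumes ancient: "ancient \<omega> x" "ancient \<omega> y" and xy: "snd x = snd y" "fst x < fst y"
    and no_ray: "\<And>u. u \<in> lattice \<Longrightarrow> \<exists>k. (u + (int k, int k), u + (int (Suc k), int (Suc k))) \<notin> open_edges \<omega>"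
  shows "\<exists>\<omega>'. finite {e. \<omega>' e \<noteq> \<omega> e} \<and> {e. \<omega>' e \<noteq> \<omega> e} \<subseteq> lattice_edges \<and> \<not> never_merges \<omega>'"
proof -
  define l where "l = snd x"
  define s where "s k = x + (int k, int k)" for k
  define \<pi> where "\<pi> k = (step \<omega> ^^ k) y" for k
  define gap where "gap k = fst (\<pi> k) - fst (s k)" for k
  have x: "x \<in> percolation_points \<omega>" and y: "y \<in> percolation_points \<omega>"
    using ancient ancient_percolates by blast+
  have \<pi>K: "\<pi> k \<in> percolation_points \<omega>" for k unfolding \<pi>_def using y by (rule perc.iter_closed)
  have \<pi>Suc: "\<pi> (Suc k) = step \<omega> (\<pi> k)" for k by (simp add: \<pi>_def)
  have fst_s [simp]: "fst (s k) = fst x + int k" and snd_s [simp]: "snd (s k) = l + int k" for k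
    by (simp_all add: s_def l_def)
  have up_right_s: "up_right (s k) = s (Suc k)" for k by (simp add: prod_eq_iff)
  have s_lattice: "s k \<in> lattice" for k
    using percolation_points_lattice[OF x] by (simp add: lattice_iff l_def)
  have snd_\<pi> [simp]: "snd (\<pi> k) = l + int k" for k by (simp add: \<pi>_def l_def xy)
  have gap_even: "even (gap k)" for k
  proof -
    have "even (fst (\<pi> k) + snd (\<pi> k))" "even (fst (s k) + snd (s k))"
      using perc.even[OF \<pi>K] s_lattice lattice_iff by blast+
    then show ?thesis by (simp add: gap_def)
  qed
  have gap_step: "gap (Suc k) = gap k \<or> gap (Suc k) = gap k - 2" for k
    by (auto simp: gap_def \<pi>Suc step_def)
  have gap_0: "gap 0 > 0" using xy by (simp add: gap_def \<pi>_def)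
  have hit: "\<exists>k. \<pi> k = s k"
  proof (rule ccontr)
    assume "\<nexists>k. \<pi> k = s k"
    then have ne: "gap k \<noteq> 0" for k by (auto simp: gap_def prod_eq_iff)
    have pos: "gap k \<ge> 0" for k
    proof (induction k)
      case (Suc k)
      then show ?case using gap_step[of k] gap_even[of k] ne[of k] by presburger
    qed (use gap_0 in simp)
    have "gap (Suc k) \<le> gap k" for k using gap_step[of k] by auto
    then obtain m where m: "\<And>n. n \<ge> m \<Longrightarrow> gap n = gap m"
      using descent_eventually_constant[of gap] pos by blast
    \<comment> \<open>A gap that does not shrink means that the path climbs to the right, in parallel with the segment.\<close>
    have right: "\<pi> (Suc n) = up_right (\<pi> n)" if "n \<ge> m" for n
      using m[of n] m[of "Suc n"] that by (simp add: gap_def \<pi>Suc step_def split: if_splits)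
    have ray: "\<pi> (m + k) = \<pi> m + (int k, int k)" for k
      by (induction k) (simp_all add: right prod_eq_iff)
    obtain k where k: "(\<pi> m + (int k, int k), \<pi> m + (int (Suc k), int (Suc k))) \<notin> open_edges \<omega>"
      using no_ray[OF percolation_points_lattice[OF \<pi>K]] by blast
    have "(\<pi> (m + k), \<pi> (m + Suc k)) \<in> open_edges \<omega>"
      using step_edge[OF \<pi>K] \<pi>Suc by simp
    with k show False unfolding ray by blast
  qed
  define h where "h = (LEAST k. \<pi> k = s k)"
  have h: "\<pi> h = s h" unfolding h_def using hit by (rule LeastI_ex)
  have before_h: "\<pi> k \<noteq> s k" if "k < h" for k
    using that not_less_Least unfolding h_def by blast
  have right_of_s: "fst (s k) < fst (\<pi> k)" if "k < h" for k
  proof -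
    have "gap k > 0" using that
    proof (induction k)
      case (Suc k)
      have "gap (Suc k) \<noteq> 0" using before_h[OF Suc.prems] by (auto simp: gap_def prod_eq_iff)
      then show ?case using Suc gap_step[of k] gap_even[of k] by presburger
    qed (rule gap_0)
    then show ?thesis by (simp add: gap_def)
  qed

  define opened where "opened = (\<lambda>k. (s k, s (Suc k))) ` {..<h}"
  define shut where "shut = (\<lambda>k. (s k + (1, -1), s k)) ` {1..<h}"
  define \<omega>' where "\<omega>' e = (if e \<in> opened then True else if e \<in> shut then False else \<omega> e)" for e
  have opened_edges: "opened \<subseteq> lattice_edges"
    using s_lattice by (auto simp: opened_def lattice_edges_iff up_right_s)
  have shut_edges: "shut \<subseteq> lattice_edges"
  proof -
    have "s k = up_left (s k + (1, -1))" "s k + (1, -1) \<in> lattice" for k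
      using s_lattice[of k] by (auto simp: prod_eq_iff lattice_iff)
    then show ?thesis by (auto simp only: shut_def lattice_edges_iff)
  qed
  have "{e. \<omega>' e \<noteq> \<omega> e} \<subseteq> opened \<union> shut" by (auto simp: \<omega>'_def)
  moreover have "finite (opened \<union> shut)" by (simp add: opened_def shut_def)
  ultimately have diff: "finite {e. \<omega>' e \<noteq> \<omega> e}" "{e. \<omega>' e \<noteq> \<omega> e} \<subseteq> lattice_edges"
    using opened_edges shut_edges finite_subset by blast+
  have open': "e \<in> open_edges \<omega>' \<longleftrightarrow> e \<in> opened \<or> e \<in> open_edges \<omega> \<and> e \<notin> shut" for e
    using opened_edges by (auto simp: open_edges_def \<omega>'_def)
  have openedD: "\<exists>k<h. u = s k \<and> v = s (Suc k)" if "(u, v) \<in> opened" for u v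
    using that unfolding opened_def by blast
  have shutD: "\<exists>k. 1 \<le> k \<and> k < h \<and> u = s k + (1, -1) \<and> v = s k" if "(u, v) \<in> shut" for u v
    using that unfolding shut_def by auto

  have survives': "survives \<omega>' n u \<longleftrightarrow> survives \<omega> n u" if "snd u \<ge> l + int h" for n u
    using that
  proof (induction n arbitrary: u)
    case (Suc n)
    have "(u, v) \<in> open_edges \<omega>' \<longleftrightarrow> (u, v) \<in> open_edges \<omega>" for v
      using openedD[of u v] shutD[of u v] Suc.prems by (auto simp: open')
    with Suc.IH[of "up_right u"] Suc.IH[of "up_left u"] Suc.prems show ?case by simp
  qed simp
  \<comment> \<open>From height h on nothing has changed.\<close>
  have top: "u \<in> percolation_points \<omega>' \<longleftrightarrow> u \<in> percolation_points \<omega>" if "snd u \<ge> l + int h" for u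
    using survives'[OF that] by (simp add: percolation_points_iff)
  have segment_open: "(s k, s (Suc k)) \<in> open_edges \<omega>'" if "k < h" for k
    using that by (auto simp: open' opened_def)
  have s_percolates: "s k \<in> percolation_points \<omega>'" if "k \<le> h" for k
    using that
  proof (induction k rule: inc_induct)
    case base
    then show ?case using top[of "s h"] \<pi>K[of h] h by simp
  next
    case (step k)
    then show ?case using percolation_points_edge segment_open by blast
  qed
  have segment_step: "(step \<omega>' ^^ k) x = s k" if "k \<le> h" for k
    using that
  proof (induction k)
    case (Suc k)
    then show ?case
      using segment_open[of k] s_percolates[of "Suc k"] by (simp add: step_def up_right_s)
  qed (simp add: s_def prod_eq_iff)

  \<comment> \<open>Downwards from height h: a path from outside enters the interior of the segment only through x.\<close>
  have no_new: "u \<in> percolation_points \<omega>"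
    if "u \<in> percolation_points \<omega>'" "snd u \<le> l + int h" "\<And>k. 1 \<le> k \<Longrightarrow> k < h \<Longrightarrow> u \<noteq> s k" for u
    using that
  proof (induction "nat (l + int h - snd u)" arbitrary: u)
    case 0
    then show ?case using top[of u] by simp
  next
    case (Suc n)
    show ?case
    proof (cases "u = x")
      case False
      let ?v = "step \<omega>' u"
      have uv: "(u, ?v) \<in> open_edges \<omega>'" and v: "?v \<in> percolation_points \<omega>'"
        using Suc.prems(1) step_edge step_closed by blast+
      have "u \<noteq> s k" if "k < h" for k
        using Suc.prems(3)[of k] that False by (cases "k = 0") (auto simp: s_def prod_eq_iff)
      then have not_opened: "(u, ?v) \<notin> opened" using openedD by blast
      then have uv': "(u, ?v) \<in> open_edges \<omega>" "(u, ?v) \<notin> shut" using uv open' by blast+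
      have snd_v: "snd ?v = snd u + 1" by simp
      have "?v \<noteq> s k" if k: "1 \<le> k" "k < h" for k
      proof
        assume vs: "?v = s k"
        have "u = s (k - 1) \<or> u = s k + (1, -1)"
          using open_edgesD[OF uv'(1)] k vs by (auto simp: prod_eq_iff of_nat_diff)
        moreover have "u \<noteq> s (k - 1)" using \<open>\<And>k. k < h \<Longrightarrow> u \<noteq> s k\<close>[of "k - 1"] k by simp
        ultimately have "(u, ?v) \<in> shut" using k vs by (auto simp: shut_def)
        with uv' show False by blast
      qed
      then have "?v \<in> percolation_points \<omega>"
        using Suc.hyps(1)[of ?v] Suc.hyps(2) Suc.prems(2) v snd_v by simp
      with uv'(1) show ?thesis by (rule percolation_points_edge)
    qed (use x in simp)
  qed

  \<comment> \<open>A vertex that moved right still does so, and one that moved left has not gained its upper right neighbour.\<close>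
  have keep: "u \<in> percolation_points \<omega>' \<and> step \<omega>' u = step \<omega> u"
    if u: "u \<in> percolation_points \<omega>" "step \<omega> u \<in> percolation_points \<omega>'" "snd u < l + int h"
      and off: "(u, step \<omega> u) \<notin> shut" "\<And>k. k < h \<Longrightarrow> u \<noteq> s k"
        "\<And>k. 1 \<le> k \<Longrightarrow> k < h \<Longrightarrow> up_right u \<noteq> s k" for u
  proof -
    have not_opened: "(u, v) \<notin> opened" for v using openedD off(2) by blast
    have edge: "(u, step \<omega> u) \<in> open_edges \<omega>'" using step_edge[OF u(1)] off(1) open' by blast
    then have uK: "u \<in> percolation_points \<omega>'" using u(2) by (rule percolation_points_edge)
    have "step \<omega>' u = step \<omega> u"
    proof (cases "step \<omega> u = up_right u")
      case True
      then show ?thesis using edge u(2) by (simp add: step_def)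
    next
      case False
      have "\<not> ((u, up_right u) \<in> open_edges \<omega>' \<and> up_right u \<in> percolation_points \<omega>')"
      proof
        assume r: "(u, up_right u) \<in> open_edges \<omega>' \<and> up_right u \<in> percolation_points \<omega>'"
        then have "(u, up_right u) \<in> open_edges \<omega>" using open' not_opened by blast
        moreover have "up_right u \<in> percolation_points \<omega>" using no_new[of "up_right u"] r u(3) off(3) by simp
        ultimately show False using False by (simp add: step_def)
      qed
      then show ?thesis using False by (auto simp: step_def)
    qed
    with uK show ?thesis by blast
  qed

  have \<pi>_keep: "\<pi> k \<in> percolation_points \<omega>' \<and> (k < h \<longrightarrow> step \<omega>' (\<pi> k) = \<pi> (Suc k))" if "k \<le> h" for k
    using that
  proof (induction k rule: inc_induct)
    case base
    then show ?case using s_percolates[of h] h by simp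
  next
    case (step k)
    have "(\<pi> k, \<pi> (Suc k)) \<notin> shut"
    proof
      assume "(\<pi> k, \<pi> (Suc k)) \<in> shut"
      then obtain j where "1 \<le> j" "j < h" "\<pi> (Suc k) = s j" using shutD by blast
      moreover from this have "j = Suc k" using snd_\<pi>[of "Suc k"] by simp
      ultimately show False using before_h by blast
    qed
    moreover have "\<pi> k \<noteq> s j" for j
      using right_of_s[OF step(2)] snd_\<pi>[of k] by (metis snd_s add_left_cancel less_irrefl of_nat_eq_iff)
    moreover have "up_right (\<pi> k) \<noteq> s j" for j
    proof
      assume r: "up_right (\<pi> k) = s j"
      have "snd (up_right (\<pi> k)) = snd (s j)" "fst (up_right (\<pi> k)) = fst (s j)" by (simp_all only: r)
      then have "l + int k + 1 = l + int j" "fst (\<pi> k) + 1 = fst x + int j"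
        unfolding up_right_simps snd_s fst_s snd_\<pi> .
      then show False using right_of_s[OF step(2)] by simp
    qed
    ultimately show ?case using keep[of "\<pi> k"] \<pi>K step \<pi>Suc by simp
  qed
  have \<pi>_step: "(step \<omega>' ^^ k) y = \<pi> k" if "k \<le> h" for k
    using that by (induction k) (use \<pi>_keep in \<open>auto simp: \<pi>_def\<close>)

  \<comment> \<open>All modified edges start at or above the level of x and y.\<close>
  have below_keep: "u \<in> percolation_points \<omega>' \<and> (step \<omega>' ^^ n) u = (step \<omega> ^^ n) u"
    if "u \<in> percolation_points \<omega>" "snd u + int n = l" "(step \<omega> ^^ n) u \<in> percolation_points \<omega>'" for u n
    using that
  proof (induction n arbitrary: u)
    case (Suc n)
    have d: "step \<omega> u \<in> percolation_points \<omega>' \<and> (step \<omega>' ^^ n) (step \<omega> u) = (step \<omega> ^^ n) (step \<omega> u)"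
      using Suc.IH[of "step \<omega> u"] Suc.prems step_closed by (simp add: funpow_swap1)
    have low: "snd u < l" using Suc.prems(2) by simp
    have "(u, step \<omega> u) \<notin> shut" using shutD[of u "step \<omega> u"] low by auto
    moreover have "u \<noteq> s k" for k using low by auto
    moreover have "up_right u \<noteq> s k" if "1 \<le> k" for k
      using low that by (auto simp: prod_eq_iff)
    ultimately have "u \<in> percolation_points \<omega>' \<and> step \<omega>' u = step \<omega> u"
      using keep[of u] Suc.prems(1) d low by simp
    with d show ?case by (simp add: funpow_swap1)
  qed simp
  have still_ancient: "ancient \<omega>' z"
    if z: "ancient \<omega> z" "snd z = l" "z \<in> percolation_points \<omega>'" for z
    unfolding ancient_def has_descendant_def
  proof
    fix n
    obtain u where u: "u \<in> percolation_points \<omega>" "(step \<omega> ^^ n) u = z"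
      using z(1) unfolding ancient_def has_descendant_def by blast
    have "snd u + int n = l" using arg_cong[OF u(2), of snd] z(2) by simp
    then show "\<exists>u\<in>percolation_points \<omega>'. (step \<omega>' ^^ n) u = z"
      using below_keep[of u n] u z(3) by auto
  qed
  have "ancient \<omega>' x" using still_ancient[OF ancient(1)] s_percolates[of 0] by (simp add: l_def s_def zero_prod_def[symmetric])
  moreover have "ancient \<omega>' y" using still_ancient[OF ancient(2)] \<pi>_keep[of 0] xy by (simp add: l_def \<pi>_def)
  moreover have "(step \<omega>' ^^ h) x = (step \<omega>' ^^ h) y" using segment_step \<pi>_step h by simp
  ultimately have "\<not> never_merges \<omega>'" using never_merges_iter xy(2) by blast
  with diff show ?thesis by blast
qed

section \<open>Measurability and stationarity\<close>

lemma prob_space_percolation: "prob_space (percolation p)"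
  unfolding percolation_def by (intro prob_space_PiM measure_pmf.prob_space_axioms)

interpretation percolation: prob_space "percolation p" for p
  by (rule prob_space_percolation)

lemma measurable_edge_state:
  "e \<in> lattice_edges \<Longrightarrow> (\<lambda>\<omega>. \<omega> e) \<in> percolation p \<rightarrow>\<^sub>M measure_pmf (bernoulli_pmf p)"
  unfolding percolation_def by (rule measurable_component_singleton)

lemma measurable_update_edge:
  assumes "e \<in> lattice_edges"
  shows "(\<lambda>\<omega>. fun_upd \<omega> e b) \<in> percolation p \<rightarrow>\<^sub>M percolation p"
  unfolding percolation_def
  by (rule measurable_fun_upd[of _ lattice_edges]) (use assms in auto)

lemma pred_open_edge [measurable]: "Measurable.pred (percolation p) (\<lambda>\<omega>. e \<in> open_edges \<omega>)"
proof (cases "e \<in> lattice_edges")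
  case True
  then have "Measurable.pred (percolation p) (\<lambda>\<omega>. \<omega> e)"
    using measurable_edge_state[OF True, of p]
    by (simp add: measurable_cong_sets[OF refl sets_measure_pmf_count_space])
  with True show ?thesis by (simp add: open_edges_def)
qed (simp add: open_edges_def)

lemma pred_survives [measurable]: "Measurable.pred (percolation p) (\<lambda>\<omega>. survives \<omega> n u)"
proof (induction n arbitrary: u)
  case (Suc n)
  note Suc [measurable]
  show ?case by simp
qed simp

lemma pred_percolation_point [measurable]:
  "Measurable.pred (percolation p) (\<lambda>\<omega>. u \<in> percolation_points \<omega>)"
  unfolding percolation_points_iff by measurable

lemma pred_step [measurable]: "Measurable.pred (percolation p) (\<lambda>\<omega>. step \<omega> u = v)"
  unfolding step_def by measurable

lemma pred_step_iter [measurable]: "Measurable.pred (percolation p) (\<lambda>\<omega>. (step \<omega> ^^ n) u = v)"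
proof (induction n arbitrary: v)
  case (Suc n)
  note Suc [measurable]
  have "(step \<omega> ^^ Suc n) u = v \<longleftrightarrow> (\<exists>w. (step \<omega> ^^ n) u = w \<and> step \<omega> w = v)" for \<omega>
    by simp
  then show ?case by (simp only:) measurable
qed simp

lemma pred_has_descendant [measurable]: "Measurable.pred (percolation p) (\<lambda>\<omega>. has_descendant \<omega> n v)"
  unfolding has_descendant_def Bex_def by measurable

lemma pred_ancient [measurable]: "Measurable.pred (percolation p) (\<lambda>\<omega>. ancient \<omega> v)"
  unfolding ancient_def by measurable

lemma pred_rightmost_descendant [measurable]:
  "Measurable.pred (percolation p) (\<lambda>\<omega>. rightmost_descendant \<omega> n u)"
proof -
  have "rightmost_descendant \<omega> n u \<longleftrightarrow> u \<in> percolation_points \<omega> \<and>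
     (\<forall>w v. w \<in> percolation_points \<omega> \<longrightarrow> (step \<omega> ^^ n) w = v \<longrightarrow> (step \<omega> ^^ n) u = v \<longrightarrow> fst w \<le> fst u)" for \<omega>
    unfolding rightmost_descendant_def by auto
  then show ?thesis by (simp only:) measurable
qed

lemma pred_never_merges [measurable]: "Measurable.pred (percolation p) never_merges"
proof -
  have "never_merges \<omega> \<longleftrightarrow> (\<forall>a b v. ancient \<omega> a \<longrightarrow> ancient \<omega> b \<longrightarrow>
    step \<omega> a = v \<longrightarrow> step \<omega> b = v \<longrightarrow> a = b)" for \<omega>
    unfolding never_merges_def by auto
  then show ?thesis by (simp only: fun_eq_iff[of never_merges] cong: measurable_cong) measurable
qed

definition shift_edge :: "vertex \<Rightarrow> edge \<Rightarrow> edge" where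
  "shift_edge t e = (fst e + t, snd e + t)"

definition shift :: "vertex \<Rightarrow> config \<Rightarrow> config" where
  "shift t \<omega> = (\<lambda>e\<in>lattice_edges. \<omega> (shift_edge t e))"

lemma up_right_add: "up_right (u + t) = up_right u + t" and up_left_add: "up_left (u + t) = up_left u + t"
  by (simp_all add: up_right_def up_left_def add_ac)

lemma lattice_add_iff: "t \<in> lattice \<Longrightarrow> u + t \<in> lattice \<longleftrightarrow> u \<in> lattice"
  unfolding lattice_iff fst_add snd_add by presburger

lemma shift_edge_lattice_iff:
  assumes "t \<in> lattice"
  shows "shift_edge t e \<in> lattice_edges \<longleftrightarrow> e \<in> lattice_edges"
proof -
  obtain u v where e: "e = (u, v)" by (cases e)
  show ?thesis
    by (simp add: e shift_edge_def lattice_edges_iff lattice_add_iff[OF assms] up_right_add up_left_add)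
qed

lemma distr_shift:
  assumes "t \<in> lattice"
  shows "distr (percolation p) (percolation p) (shift t) = percolation p"
  unfolding percolation_def shift_def
proof (rule distr_PiM_reindex)
  show "inj_on (shift_edge t) lattice_edges"
    by (auto simp: inj_on_def shift_edge_def)
  show "shift_edge t \<in> lattice_edges \<rightarrow> lattice_edges"
    using shift_edge_lattice_iff[OF assms] by blast
qed (rule measure_pmf.prob_space_axioms)

lemma measurable_shift:
  assumes "t \<in> lattice"
  shows "shift t \<in> percolation p \<rightarrow>\<^sub>M percolation p"
  unfolding percolation_def shift_def
  using shift_edge_lattice_iff[OF assms] by (intro measurable_restrict measurable_component_singleton) blast

context
  fixes t :: vertex assumes t: "t \<in> lattice"
begin

lemma open_edges_shift: "(u, v) \<in> open_edges (shift t \<omega>) \<longleftrightarrow> (u + t, v + t) \<in> open_edges \<omega>"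
  using shift_edge_lattice_iff[OF t, of "(u, v)"] by (auto simp: open_edges_def shift_def shift_edge_def)

lemma survives_shift: "survives (shift t \<omega>) n u \<longleftrightarrow> survives \<omega> n (u + t)"
  by (induction n arbitrary: u) (simp_all add: open_edges_shift up_right_add up_left_add)

lemma percolation_points_shift: "u \<in> percolation_points (shift t \<omega>) \<longleftrightarrow> u + t \<in> percolation_points \<omega>"
  by (simp add: percolation_points_iff survives_shift lattice_add_iff[OF t])

lemma step_shift: "step (shift t \<omega>) u + t = step \<omega> (u + t)"
  by (simp add: step_def open_edges_shift percolation_points_shift up_right_add up_left_add)

lemma step_iter_shift: "(step (shift t \<omega>) ^^ n) u + t = (step \<omega> ^^ n) (u + t)"
  by (induction n) (simp_all add: step_shift)

lemma has_descendant_shift: "has_descendant (shift t \<omega>) n v \<longleftrightarrow> has_descendant \<omega> n (v + t)"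
proof
  assume "has_descendant (shift t \<omega>) n v"
  then obtain u where "u + t \<in> percolation_points \<omega>" "(step (shift t \<omega>) ^^ n) u = v"
    by (auto simp: has_descendant_def percolation_points_shift)
  then show "has_descendant \<omega> n (v + t)"
    unfolding has_descendant_def by (intro bexI[of _ "u + t"]) (simp_all add: step_iter_shift[symmetric])
next
  assume "has_descendant \<omega> n (v + t)"
  then obtain u where u: "u \<in> percolation_points \<omega>" "(step \<omega> ^^ n) u = v + t"
    unfolding has_descendant_def by blast
  have "u - t \<in> percolation_points (shift t \<omega>)" using u(1) by (simp add: percolation_points_shift)
  moreover have "(step (shift t \<omega>) ^^ n) (u - t) = v"
    using step_iter_shift[of n \<omega> "u - t"] u(2) by simp
  ultimately show "has_descendant (shift t \<omega>) n v" unfolding has_descendant_def by blast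
qed

lemma ancient_shift: "ancient (shift t \<omega>) v \<longleftrightarrow> ancient \<omega> (v + t)"
  by (simp add: ancient_def has_descendant_shift)

lemma rightmost_descendant_shift: "rightmost_descendant (shift t \<omega>) n u \<longleftrightarrow> rightmost_descendant \<omega> n (u + t)"
proof -
  have iter: "(step (shift t \<omega>) ^^ n) w = (step (shift t \<omega>) ^^ n) u
      \<longleftrightarrow> (step \<omega> ^^ n) (w + t) = (step \<omega> ^^ n) (u + t)" for w
    by (simp add: step_iter_shift[symmetric])
  have "(\<forall>w. P (w + t)) \<longleftrightarrow> (\<forall>w. P w)" for P
    by (metis diff_add_cancel)
  from this[of "\<lambda>w. w \<in> percolation_points \<omega> \<longrightarrow> (step \<omega> ^^ n) w = (step \<omega> ^^ n) (u + t) \<longrightarrow> fst w \<le> fst (u + t)"]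
  show ?thesis
    unfolding rightmost_descendant_def Ball_def iter percolation_points_shift by simp
qed

text \<open>
  Together with the covariance lemmas above, this says that the forest has the same law seen from
  every vertex of the lattice.
\<close>
lemma prob_shift:
  assumes "Measurable.pred (percolation p) A"
  shows "\<P>(\<omega> in percolation p. A (shift t \<omega>)) = \<P>(\<omega> in percolation p. A \<omega>)"
proof -
  have "\<P>(\<omega> in percolation p. A \<omega>) = measure (distr (percolation p) (percolation p) (shift t)) {\<omega> \<in> space (percolation p). A \<omega>}"
    by (simp add: distr_shift[OF t])
  also have "\<dots> = measure (percolation p) (shift t -` {\<omega> \<in> space (percolation p). A \<omega>} \<inter> space (percolation p))"
    using assms by (intro measure_distr measurable_shift t) measurable
  also have "shift t -` {\<omega> \<in> space (percolation p). A \<omega>} \<inter> space (percolation p)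
      = {\<omega> \<in> space (percolation p). A (shift t \<omega>)}"
    using measurable_space[OF measurable_shift[OF t]] by blast
  finally show ?thesis ..
qed

end

section \<open>Finite energy and the absence of merging\<close>

text \<open>
  Let \<open>a\<close> and \<open>b\<close> be the possible daughters of \<open>v\<close>. By stationarity, the event that \<open>a\<close> is an ancient daughter
  is as likely as the event that \<open>v\<close> is ancient and climbs to the right, and correspondingly for \<open>b\<close> and
  the left. So the two probabilities add up to the probability that \<open>v\<close> is ancient, which is
  also the probability of the union of the two events, and no room is left for their intersection.
\<close>
lemma AE_never_merges: "AE \<omega> in percolation p. never_merges \<omega>"
proof -
  have no_merge: "AE \<omega> in percolation p. \<not> (ancient \<omega> a \<and> step \<omega> a = v \<and> ancient \<omega> b \<and> step \<omega> b = v)"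
    if ab: "up_right a = v" "up_left b = v" and v: "v \<in> lattice" for a b v
  proof -
    define L where "L = {\<omega> \<in> space (percolation p). ancient \<omega> a \<and> step \<omega> a = v}"
    define R where "R = {\<omega> \<in> space (percolation p). ancient \<omega> b \<and> step \<omega> b = v}"
    have sets [measurable]: "L \<in> sets (percolation p)" "R \<in> sets (percolation p)"
      unfolding L_def R_def by measurable
    have a: "a = v + (-1, -1)" and b: "b = v + (1, -1)"
      using ab by (auto simp: prod_eq_iff)
    have "\<P>(\<omega> in percolation p. ancient \<omega> v \<and> step \<omega> v = up_right v)
        = \<P>(\<omega> in percolation p. ancient (shift (-1, -1) \<omega>) v \<and> step (shift (-1, -1) \<omega>) v = up_right v)"
      by (rule prob_shift[symmetric]) (simp_all add: lattice_iff)
    also have "\<dots> = percolation.prob p L"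
    proof -
      have "step (shift (-1, -1) \<omega>) v = up_right v \<longleftrightarrow> step \<omega> a = v" for \<omega>
        using step_shift[of "(-1, -1)" \<omega> v] by (auto simp: lattice_iff a prod_eq_iff)
      then show ?thesis by (simp add: L_def ancient_shift lattice_iff a)
    qed
    finally have L: "\<P>(\<omega> in percolation p. ancient \<omega> v \<and> step \<omega> v = up_right v) = percolation.prob p L" .
    have "\<P>(\<omega> in percolation p. ancient \<omega> v \<and> step \<omega> v = up_left v)
        = \<P>(\<omega> in percolation p. ancient (shift (1, -1) \<omega>) v \<and> step (shift (1, -1) \<omega>) v = up_left v)"
      by (rule prob_shift[symmetric]) (simp_all add: lattice_iff)
    also have "\<dots> = percolation.prob p R"
    proof -
      have "step (shift (1, -1) \<omega>) v = up_left v \<longleftrightarrow> step \<omega> b = v" for \<omega>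
        using step_shift[of "(1, -1)" \<omega> v] by (auto simp: lattice_iff b prod_eq_iff)
      then show ?thesis by (simp add: R_def ancient_shift lattice_iff b)
    qed
    finally have R: "\<P>(\<omega> in percolation p. ancient \<omega> v \<and> step \<omega> v = up_left v) = percolation.prob p R" .
    have "percolation.prob p (L \<union> R) = \<P>(\<omega> in percolation p. ancient \<omega> v)"
    proof (rule arg_cong[where f = "percolation.prob p"])
      have "ancient \<omega> v \<longleftrightarrow> ancient \<omega> a \<and> step \<omega> a = v \<or> ancient \<omega> b \<and> step \<omega> b = v" for \<omega>
      proof
        assume "ancient \<omega> v"
        then obtain d where "step \<omega> d = v" "ancient \<omega> d" using ancient_daughter by blast
        moreover have "d = a \<or> d = b"
          using \<open>step \<omega> d = v\<close> ab by (auto simp: step_def prod_eq_iff split: if_splits)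
        ultimately show "ancient \<omega> a \<and> step \<omega> a = v \<or> ancient \<omega> b \<and> step \<omega> b = v" by blast
      qed (use ancient_step in blast)
      then show "L \<union> R = {\<omega> \<in> space (percolation p). ancient \<omega> v}"
        unfolding L_def R_def by blast
    qed
    also have "\<dots> = \<P>(\<omega> in percolation p. ancient \<omega> v \<and> step \<omega> v = up_right v)
        + \<P>(\<omega> in percolation p. ancient \<omega> v \<and> step \<omega> v = up_left v)"
    proof -
      have split: "{\<omega> \<in> space (percolation p). ancient \<omega> v} =
          {\<omega> \<in> space (percolation p). ancient \<omega> v \<and> step \<omega> v = up_right v} \<union>
          {\<omega> \<in> space (percolation p). ancient \<omega> v \<and> step \<omega> v = up_left v}"
        by (auto simp: step_def)
      show ?thesis
        by (subst split, rule percolation.finite_measure_Union) (measurable, auto)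
    qed
    finally have "percolation.prob p (L \<inter> R) = 0"
      using measure_Un3[of L "percolation p" R]
      by (simp add: L R percolation.fmeasurable_eq_sets)
    then have "AE \<omega> in percolation p. \<omega> \<notin> L \<inter> R"
      using percolation.prob_eq_0[of "L \<inter> R" p] by simp
    then show ?thesis
      by (rule AE_mp) (auto simp: L_def R_def)
  qed
  have "AE \<omega> in percolation p. \<forall>a b v. up_right a = v \<longrightarrow> up_left b = v \<longrightarrow> v \<in> lattice \<longrightarrow>
      \<not> (ancient \<omega> a \<and> step \<omega> a = v \<and> ancient \<omega> b \<and> step \<omega> b = v)"
    unfolding AE_all_countable
  proof (intro allI)
    fix a b v
    show "AE \<omega> in percolation p. up_right a = v \<longrightarrow> up_left b = v \<longrightarrow> v \<in> lattice \<longrightarrow>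
      \<not> (ancient \<omega> a \<and> step \<omega> a = v \<and> ancient \<omega> b \<and> step \<omega> b = v)"
      using no_merge[of a v b] by (cases "up_right a = v \<and> up_left b = v \<and> v \<in> lattice") auto
  qed
  then show ?thesis
  proof (rule AE_mp, intro AE_I2 impI)
    fix \<omega>
    assume no: "\<forall>a b v. up_right a = v \<longrightarrow> up_left b = v \<longrightarrow> v \<in> lattice \<longrightarrow>
      \<not> (ancient \<omega> a \<and> step \<omega> a = v \<and> ancient \<omega> b \<and> step \<omega> b = v)"
    show "never_merges \<omega>" unfolding never_merges_def
    proof (intro allI impI)
      fix a b assume ab: "ancient \<omega> a" "ancient \<omega> b" "step \<omega> a = step \<omega> b"
      have lat: "step \<omega> a \<in> lattice"
        using ab(1) ancient_step ancient_percolates percolation_points_lattice by blast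
      show "a = b"
      proof (rule ccontr)
        assume "a \<noteq> b"
        then have "up_right a = step \<omega> a \<and> up_left b = step \<omega> a \<or> up_right b = step \<omega> a \<and> up_left a = step \<omega> a"
          using ab(3) by (auto simp: step_def prod_eq_iff split: if_splits)
        then show False using no lat ab by metis
      qed
    qed
  qed
qed

text \<open>
  Resampling the state of one edge independently does not change the law. As the value \<open>b\<close> is drawn with
  positive probability, an event that is almost sure for the resampled configuration remains almost sure
  when the value is forced to be \<open>b\<close>.
\<close>
lemma AE_update_edge:
  assumes Q [measurable]: "Measurable.pred (percolation p) Q" and AE: "AE \<omega> in percolation p. Q \<omega>"
    and e: "e \<in> lattice_edges" and p: "pmf (bernoulli_pmf p) b > 0"
  shows "AE \<omega> in percolation p. Q (fun_upd \<omega> e b)"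
proof -
  let ?B = "measure_pmf (bernoulli_pmf p)"
  define rest where "rest = (\<Pi>\<^sub>M i\<in>lattice_edges - {e}. ?B)"
  have ins: "insert e (lattice_edges - {e}) = lattice_edges" using e by blast
  interpret rest: prob_space rest
    unfolding rest_def by (intro prob_space_PiM measure_pmf.prob_space_axioms)
  interpret pair_prob_space ?B rest ..
  define join where "join = (\<lambda>(x, X). (fun_upd X e x :: config))"
  \<comment> \<open>The law is the product of the law of one edge and the law of all other edges.\<close>
  have join: "distr (?B \<Otimes>\<^sub>M rest) (percolation p) join = percolation p"
    using distr_pair_PiM_eq_PiM[of "lattice_edges - {e}" "\<lambda>_. ?B" e]
    unfolding percolation_def rest_def join_def ins by (simp add: measure_pmf.prob_space_axioms)
  have join_meas [measurable]: "join \<in> ?B \<Otimes>\<^sub>M rest \<rightarrow>\<^sub>M percolation p"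
    unfolding join_def percolation_def rest_def split_beta
    by (rule measurable_fun_upd[of _ "lattice_edges - {e}"]) (use e in auto)
  have upd_meas [measurable]: "(\<lambda>\<omega>. fun_upd \<omega> e b) \<in> percolation p \<rightarrow>\<^sub>M percolation p"
    by (rule measurable_update_edge[OF e])
  have "AE z in ?B \<Otimes>\<^sub>M rest. Q (join z)"
    using AE_distr_iff[OF join_meas, of Q] AE unfolding join by simp
  then have "AE x in ?B. AE X in rest. Q (fun_upd X e x)"
    using AE_pair[of "\<lambda>z. Q (join z)"] by (simp add: join_def)
  then have fixed: "AE X in rest. Q (fun_upd X e b)"
    using p by (simp add: AE_measure_pmf_iff set_pmf_iff)
  have "AE z in ?B \<Otimes>\<^sub>M rest. Q (fun_upd (join z) e b)"
  proof (rule AE_pair_measure)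
    show "AE x in ?B. AE X in rest. Q (fun_upd (join (x, X)) e b)"
      using fixed by (simp add: join_def)
  qed measurable
  then have "AE \<omega> in distr (?B \<Otimes>\<^sub>M rest) (percolation p) join. Q (fun_upd \<omega> e b)"
    by (subst AE_distr_iff) measurable
  then show ?thesis unfolding join .
qed

fun modify :: "(edge \<times> bool) list \<Rightarrow> config \<Rightarrow> config" where
  "modify [] \<omega> = \<omega>"
| "modify ((e, b) # ms) \<omega> = modify ms (fun_upd \<omega> e b)"

lemma modify_map:
  "modify (map (\<lambda>e. (e, f e)) es) \<omega> = (\<lambda>e. if e \<in> set es then f e else \<omega> e)"
  by (induction es arbitrary: \<omega>) (auto simp: fun_eq_iff)

lemma measurable_modify:
  "fst ` set ms \<subseteq> lattice_edges \<Longrightarrow> modify ms \<in> percolation p \<rightarrow>\<^sub>M percolation p"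
proof (induction ms)
  case (Cons m ms)
  obtain e b where m: "m = (e, b)" by (cases m)
  have "(\<lambda>\<omega>. modify ms (fun_upd \<omega> e b)) \<in> percolation p \<rightarrow>\<^sub>M percolation p"
    using Cons by (intro measurable_compose[OF measurable_update_edge]) (auto simp: m)
  then show ?case by (simp add: m)
next
  case Nil
  have "modify [] = (\<lambda>\<omega>. \<omega>)" by (simp add: fun_eq_iff)
  then show ?case by simp
qed

lemma AE_modify:
  assumes p: "0 < p" "p < 1" and ms: "fst ` set ms \<subseteq> lattice_edges"
    and Q: "Measurable.pred (percolation p) Q" and AE: "AE \<omega> in percolation p. Q \<omega>"
  shows "AE \<omega> in percolation p. Q (modify ms \<omega>)"
  using ms
proof (induction ms)
  case (Cons m ms)
  obtain e b where m: "m = (e, b)" by (cases m)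
  have "set_pmf (bernoulli_pmf p) = UNIV" using p by (rule set_pmf_bernoulli)
  then have "pmf (bernoulli_pmf p) b > 0" by (auto intro: pmf_positive)
  moreover have "Measurable.pred (percolation p) (\<lambda>\<omega>. Q (modify ms \<omega>))"
    using Cons.prems by (intro measurable_compose[OF measurable_modify Q]) auto
  ultimately have "AE \<omega> in percolation p. Q (modify ms (fun_upd \<omega> e b))"
    using Cons by (intro AE_update_edge) (auto simp: m)
  then show ?case by (simp add: m)
qed (simp add: AE)

text \<open>
  There are only countably many finite lists of edge states, so that all finite modifications can be
  treated at the same time.
\<close>
lemma AE_finite_modification:
  assumes p: "0 < p" "p < 1"
    and Q: "Measurable.pred (percolation p) Q" and AE: "AE \<omega> in percolation p. Q \<omega>"
  shows "AE \<omega> in percolation p. \<forall>\<omega>'. finite {e. \<omega>' e \<noteq> \<omega> e} \<longrightarrow> {e. \<omega>' e \<noteq> \<omega> e} \<subseteq> lattice_edges \<longrightarrow> Q \<omega>'"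
proof -
  have "AE \<omega> in percolation p. \<forall>ms. fst ` set ms \<subseteq> lattice_edges \<longrightarrow> Q (modify ms \<omega>)"
    unfolding AE_all_countable
  proof
    fix ms :: "(edge \<times> bool) list"
    show "AE \<omega> in percolation p. fst ` set ms \<subseteq> lattice_edges \<longrightarrow> Q (modify ms \<omega>)"
      using AE_modify[OF p _ Q AE, of ms] by (cases "fst ` set ms \<subseteq> lattice_edges") auto
  qed
  then show ?thesis
  proof (rule AE_mp, intro AE_I2 impI allI)
    fix \<omega> \<omega>'
    assume all: "\<forall>ms. fst ` set ms \<subseteq> lattice_edges \<longrightarrow> Q (modify ms \<omega>)"
      and fin: "finite {e. \<omega>' e \<noteq> \<omega> e}" and sub: "{e. \<omega>' e \<noteq> \<omega> e} \<subseteq> lattice_edges"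
    obtain es where es: "set es = {e. \<omega>' e \<noteq> \<omega> e}" using finite_list[OF fin] by blast
    have "modify (map (\<lambda>e. (e, \<omega>' e)) es) \<omega> = \<omega>'"
      unfolding modify_map es by (simp add: fun_eq_iff)
    moreover have "fst ` set (map (\<lambda>e. (e, \<omega>' e)) es) \<subseteq> lattice_edges"
      using sub es by (simp add: image_image)
    ultimately show "Q \<omega>'" using all by metis
  qed
qed

lemma AE_no_open_ray:
  assumes p: "0 \<le> p" "p < 1"
  shows "AE \<omega> in percolation p. \<forall>u\<in>lattice. \<exists>k.
    (u + (int k, int k), u + (int (Suc k), int (Suc k))) \<notin> open_edges \<omega>"
proof -
  have ray: "AE \<omega> in percolation p. \<not> (\<forall>k. (u + (int k, int k), u + (int (Suc k), int (Suc k))) \<in> open_edges \<omega>)"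
    if u: "u \<in> lattice" for u
  proof -
    interpret product_prob_space "\<lambda>_. measure_pmf (bernoulli_pmf p)" lattice_edges ..
    define edge where "edge k = (u + (int k, int k), u + (int (Suc k), int (Suc k)))" for k
    have edge: "edge k \<in> lattice_edges" for k
      using u by (simp add: edge_def lattice_edges_iff lattice_iff prod_eq_iff)
    have inj: "inj edge" by (auto simp: inj_def edge_def prod_eq_iff)
    let ?A = "{\<omega> \<in> space (percolation p). \<forall>k. edge k \<in> open_edges \<omega>}"
    have "percolation.prob p ?A \<le> p ^ n" for n
    proof -
      have "percolation.prob p ?A \<le> percolation.prob p {\<omega> \<in> space (percolation p). \<forall>e\<in>edge ` {..<n}. \<omega> e \<in> {True}}"
      proof (rule percolation.finite_measure_mono)
        have "{\<omega> \<in> space (percolation p). \<forall>e\<in>edge ` {..<n}. \<omega> e \<in> {True}}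
          = {\<omega> \<in> space (percolation p). \<forall>k<n. edge k \<in> open_edges \<omega>}"
          using edge by (auto simp: open_edges_def)
        then show "{\<omega> \<in> space (percolation p). \<forall>e\<in>edge ` {..<n}. \<omega> e \<in> {True}} \<in> percolation.events p"
          by simp
      qed (auto simp: open_edges_def)
      also have "\<dots> = p ^ n"
      proof -
        have "emeasure (percolation p) {\<omega> \<in> space (percolation p). \<forall>e\<in>edge ` {..<n}. \<omega> e \<in> {True}}
            = (\<Prod>e\<in>edge ` {..<n}. emeasure (measure_pmf (bernoulli_pmf p)) {True})"
          unfolding percolation_def using edge by (intro emeasure_PiM_Collect) auto
        also have "\<dots> = ennreal (p ^ n)"
          using p card_image[OF inj_on_subset[OF inj subset_UNIV], of "{..<n}"]
          by (simp add: emeasure_pmf_single ennreal_power)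
        finally show ?thesis using p by (simp add: measure_def)
      qed
      finally show ?thesis .
    qed
    moreover have "(\<lambda>n. p ^ n) \<longlonglongrightarrow> 0" using p by (intro LIMSEQ_realpow_zero) auto
    ultimately have "percolation.prob p ?A \<le> 0"
      by (intro LIMSEQ_le_const[of "\<lambda>n. p ^ n"]) auto
    then have "percolation.prob p ?A = 0" by (simp add: measure_le_0_iff)
    then have "AE \<omega> in percolation p. \<omega> \<notin> ?A"
      using percolation.prob_eq_0[of ?A p] by simp
    then show ?thesis by (rule AE_mp) (auto simp: edge_def)
  qed
  have "AE \<omega> in percolation p. \<forall>u. u \<in> lattice \<longrightarrow>
      \<not> (\<forall>k. (u + (int k, int k), u + (int (Suc k), int (Suc k))) \<in> open_edges \<omega>)"
    unfolding AE_all_countable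
  proof
    fix u
    show "AE \<omega> in percolation p. u \<in> lattice \<longrightarrow>
      \<not> (\<forall>k. (u + (int k, int k), u + (int (Suc k), int (Suc k))) \<in> open_edges \<omega>)"
      using ray[of u] by (cases "u \<in> lattice") auto
  qed
  then show ?thesis by (rule AE_mp) (intro AE_I2, blast)
qed

section \<open>Ancient and permanently right-most vertices\<close>

lemma AE_ancient_unique_on_level:
  assumes p: "0 < p" "p < 1"
  shows "AE \<omega> in percolation p. \<forall>x y. ancient \<omega> x \<longrightarrow> ancient \<omega> y \<longrightarrow> snd x = snd y \<longrightarrow> x = y"
  using AE_finite_modification[OF p pred_never_merges AE_never_merges]
    AE_no_open_ray[OF less_imp_le[OF p(1)] p(2)]
proof eventually_elim
  case (elim \<omega>)
  have False if "ancient \<omega> x" "ancient \<omega> y" "snd x = snd y" "fst x < fst y" for x y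
    using merging_modification[of \<omega> x y] that elim by blast
  then show ?case by (metis linorder_neqE prod_eq_iff)
qed

lemma prob_ancient_shift:
  assumes "v \<in> lattice"
  shows "\<P>(\<omega> in percolation p. ancient \<omega> v) = \<P>(\<omega> in percolation p. ancient \<omega> 0)"
  using prob_shift[OF assms, where A = "\<lambda>\<omega>. ancient \<omega> 0"] by (simp add: ancient_shift[OF assms])

text \<open>
  The vertices \<open>(0, 0), (2, 0), (4, 0), \<dots>\<close> are ancient with the same probability, and at most one of them
  is ancient. So \<open>n\<close> times this probability is at most one for every \<open>n\<close>.
\<close>
lemma prob_ancient_0:
  assumes p: "0 < p" "p < 1"
  shows "\<P>(\<omega> in percolation p. ancient \<omega> 0) = 0"
proof -
  define r where "r = \<P>(\<omega> in percolation p. ancient \<omega> 0)"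
  define A where "A k = {\<omega> \<in> space (percolation p). ancient \<omega> (2 * int k, 0)}" for k
  have A [measurable]: "A k \<in> percolation.events p" for k unfolding A_def by measurable
  have r: "percolation.prob p (A k) = r" for k
    unfolding r_def A_def by (rule prob_ancient_shift) (simp add: lattice_iff)
  have "real n * r \<le> 1" for n
  proof -
    have "percolation.prob p (\<Union>k<n. A k) = (\<Sum>k<n. percolation.prob p (A k))"
    proof (rule measure_UNION_AE)
      show "pairwise (\<lambda>i j. AE \<omega> in percolation p. \<omega> \<notin> A i \<or> \<omega> \<notin> A j) {..<n}"
      proof (rule pairwiseI)
        fix i j :: nat assume "i \<noteq> j"
        show "AE \<omega> in percolation p. \<omega> \<notin> A i \<or> \<omega> \<notin> A j"
          using AE_ancient_unique_on_level[OF p]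
        proof (rule AE_mp, intro AE_I2 impI)
          fix \<omega> assume "\<forall>x y. ancient \<omega> x \<longrightarrow> ancient \<omega> y \<longrightarrow> snd x = snd y \<longrightarrow> x = y"
          from this[rule_format, of "(2 * int i, 0)" "(2 * int j, 0)"] \<open>i \<noteq> j\<close>
          show "\<omega> \<notin> A i \<or> \<omega> \<notin> A j" by (auto simp: A_def)
        qed
      qed
    qed (simp_all add: percolation.fmeasurable_eq_sets)
    also have "\<dots> = real n * r" by (simp add: r)
    finally show ?thesis using percolation.prob_le_1[of p "\<Union>k<n. A k"] by simp
  qed
  moreover have "r \<ge> 0" by (simp add: r_def)
  ultimately have "r = 0" using reals_Archimedean3[of r] by (metis less_eq_real_def not_le mult.commute)
  then show ?thesis by (simp add: r_def)
qed

lemma AE_not_ancient: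
  assumes p: "0 < p" "p < 1"
  shows "AE \<omega> in percolation p. \<forall>v. \<not> ancient \<omega> v"
  unfolding AE_all_countable
proof
  fix v
  show "AE \<omega> in percolation p. \<not> ancient \<omega> v"
  proof (cases "v \<in> lattice")
    case True
    then have "percolation.prob p {\<omega> \<in> space (percolation p). ancient \<omega> v} = 0"
      using prob_ancient_shift[of v p] prob_ancient_0[OF p] by simp
    then show ?thesis
      using percolation.prob_eq_0[of "{\<omega> \<in> space (percolation p). ancient \<omega> v}" p] by simp
  next
    case False
    then show ?thesis using ancient_percolates percolation_points_lattice by (intro AE_I2) blast
  qed
qed

text \<open>
  Split according to the \<open>n\<close>-th ancestor \<open>v\<close> of the origin and move \<open>v\<close> to the origin. The events become
  that \<open>- v\<close> is the right-most \<open>n\<close>-th generation descendant of the origin; they are disjoint, as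
  there is only one such descendant.
\<close>
lemma prob_rightmost_descendant_le:
  "\<P>(\<omega> in percolation p. rightmost_descendant \<omega> n 0) \<le> \<P>(\<omega> in percolation p. has_descendant \<omega> n 0)"
proof -
  define S where "S = ({- int n..int n} \<times> {int n}) \<inter> lattice"
  define A where "A v = {\<omega> \<in> space (percolation p). rightmost_descendant \<omega> n 0 \<and> (step \<omega> ^^ n) 0 = v}" for v
  define B where "B v = {\<omega> \<in> space (percolation p). rightmost_descendant \<omega> n (- v) \<and> (step \<omega> ^^ n) (- v) = 0}" for v
  have [measurable]: "A v \<in> percolation.events p" "B v \<in> percolation.events p" for v
    unfolding A_def B_def by measurable
  have "finite S" by (simp add: S_def)
  have "{\<omega> \<in> space (percolation p). rightmost_descendant \<omega> n 0} = (\<Union>v\<in>S. A v)"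
  proof (intro equalityI subsetI)
    fix \<omega> assume \<omega>: "\<omega> \<in> {\<omega> \<in> space (percolation p). rightmost_descendant \<omega> n 0}"
    let ?v = "(step \<omega> ^^ n) 0"
    have "0 \<in> percolation_points \<omega>" using \<omega> by (simp add: rightmost_descendant_def)
    then have "?v \<in> lattice" using perc.iter_closed percolation_points_lattice by blast
    moreover have "snd ?v = int n" "\<bar>fst ?v\<bar> \<le> int n"
      using perc.snd_iter[where u = 0] perc.fst_iter[where u = 0 and n = n and \<omega> = \<omega>] by simp_all
    ultimately have "?v \<in> S" by (cases ?v) (auto simp: S_def)
    with \<omega> show "\<omega> \<in> (\<Union>v\<in>S. A v)" by (auto simp: A_def simp del: split_paired_Ex)
  qed (auto simp: A_def)
  then have "\<P>(\<omega> in percolation p. rightmost_descendant \<omega> n 0) = percolation.prob p (\<Union>v\<in>S. A v)"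
    by simp
  also have "\<dots> = (\<Sum>v\<in>S. percolation.prob p (A v))"
    by (rule percolation.finite_measure_finite_Union)
      (use \<open>finite S\<close> in \<open>auto simp: disjoint_family_on_def A_def\<close>)
  also have "\<dots> = (\<Sum>v\<in>S. percolation.prob p (B v))"
  proof (rule sum.cong)
    fix v assume "v \<in> S"
    then have v: "- v \<in> lattice" by (simp add: S_def lattice_iff)
    have "(step (shift (- v) \<omega>) ^^ n) 0 = v \<longleftrightarrow> (step \<omega> ^^ n) (- v) = 0" for \<omega>
      using step_iter_shift[OF v, of n \<omega> 0] by (auto simp: eq_neg_iff_add_eq_0)
    then show "percolation.prob p (A v) = percolation.prob p (B v)"
      using prob_shift[OF v, where p = p and A = "\<lambda>\<omega>. rightmost_descendant \<omega> n 0 \<and> (step \<omega> ^^ n) 0 = v"]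
      by (simp add: A_def B_def rightmost_descendant_shift[OF v])
  qed simp
  also have "\<dots> = percolation.prob p (\<Union>v\<in>S. B v)"
  proof (rule percolation.finite_measure_finite_Union[symmetric])
    show "disjoint_family_on B S"
      unfolding disjoint_family_on_def
    proof (intro ballI impI, rule ccontr)
      fix v w assume vw: "v \<in> S" "w \<in> S" "v \<noteq> w" "B v \<inter> B w \<noteq> {}"
      then obtain \<omega> where "\<omega> \<in> B v" "\<omega> \<in> B w" by blast
      then have "- v \<in> percolation_points \<omega>" "- w \<in> percolation_points \<omega>"
        "(step \<omega> ^^ n) (- v) = 0" "(step \<omega> ^^ n) (- w) = 0"
        and right: "rightmost_descendant \<omega> n (- v)" "rightmost_descendant \<omega> n (- w)"
        by (simp_all add: B_def rightmost_descendant_def)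
      then have "fst (- v) \<le> fst (- w)" "fst (- w) \<le> fst (- v)"
        using right(2)[unfolded rightmost_descendant_def, THEN conjunct2, THEN bspec, of "- v"]
          right(1)[unfolded rightmost_descendant_def, THEN conjunct2, THEN bspec, of "- w"]
        by simp_all
      with vw show False by (auto simp: S_def prod_eq_iff)
    qed
  qed (use \<open>finite S\<close> in auto)
  also have "\<dots> \<le> \<P>(\<omega> in percolation p. has_descendant \<omega> n 0)"
  proof (rule percolation.finite_measure_mono)
    show "(\<Union>v\<in>S. B v) \<subseteq> {\<omega> \<in> space (percolation p). has_descendant \<omega> n 0}"
      unfolding B_def has_descendant_def rightmost_descendant_def by blast
  qed measurable
  finally show ?thesis .
qed

lemma AE_not_always_rightmost:
  assumes p: "0 < p" "p < 1"
  shows "AE \<omega> in percolation p. \<forall>u. \<exists>n. \<not> rightmost_descendant \<omega> n u"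
  unfolding AE_all_countable
proof
  fix u
  define D where "D n = {\<omega> \<in> space (percolation p). has_descendant \<omega> n 0}" for n
  define R where "R v = {\<omega> \<in> space (percolation p). \<forall>n. rightmost_descendant \<omega> n v}" for v
  have [measurable]: "D n \<in> percolation.events p" "R v \<in> percolation.events p" for n v
    unfolding D_def R_def by measurable
  have "percolation.prob p (R 0) \<le> percolation.prob p (D n)" for n
  proof -
    have "percolation.prob p (R 0) \<le> \<P>(\<omega> in percolation p. rightmost_descendant \<omega> n 0)"
      by (rule percolation.finite_measure_mono) (auto simp: R_def)
    then show ?thesis using prob_rightmost_descendant_le[of p n] by (simp add: D_def)
  qed
  moreover have "(\<lambda>n. percolation.prob p (D n)) \<longlonglongrightarrow> percolation.prob p (\<Inter>n. D n)"
    by (rule percolation.finite_Lim_measure_decseq)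
      (auto simp: D_def decseq_def intro: has_descendant_antimono)
  moreover have "(\<Inter>n. D n) = {\<omega> \<in> space (percolation p). ancient \<omega> 0}"
    by (auto simp: D_def ancient_def)
  ultimately have "percolation.prob p (R 0) \<le> 0"
    using LIMSEQ_le_const[of "\<lambda>n. percolation.prob p (D n)" 0] prob_ancient_0[OF p] by auto
  then have R0: "percolation.prob p (R 0) = 0" by (simp add: measure_le_0_iff)
  show "AE \<omega> in percolation p. \<exists>n. \<not> rightmost_descendant \<omega> n u"
  proof (cases "u \<in> lattice")
    case True
    have "percolation.prob p (R u) = 0"
      using prob_shift[OF True, where p = p and A = "\<lambda>\<omega>. \<forall>n. rightmost_descendant \<omega> n 0"] R0
      by (simp add: R_def rightmost_descendant_shift[OF True])
    then have "AE \<omega> in percolation p. \<omega> \<notin> R u" using percolation.prob_eq_0[of "R u" p] by simp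
    then show ?thesis by (rule AE_mp) (auto simp: R_def)
  next
    case False
    then show ?thesis
      using percolation_points_lattice unfolding rightmost_descendant_def by (intro AE_I2) blast
  qed
qed

lemma pmf_bernoulli_True_clamped: "pmf (bernoulli_pmf p) True = min 1 (max 0 p)"
  by (simp add: bernoulli_pmf.rep_eq)

lemma AE_no_percolation_point:
  assumes "p \<le> 0"
  shows "AE \<omega> in percolation p. percolation_points \<omega> = {}"
proof -
  have "AE b in measure_pmf (bernoulli_pmf p). \<not> b"
    using pmf_bernoulli_True_clamped[of p] assms by (auto simp: AE_measure_pmf_iff set_pmf_iff)
  then have "AE \<omega> in percolation p. \<not> \<omega> e" if "e \<in> lattice_edges" for e
    unfolding percolation_def using that by (intro AE_PiM_component measure_pmf.prob_space_axioms)
  then have "AE \<omega> in percolation p. e \<notin> open_edges \<omega>" for e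
    by (cases "e \<in> lattice_edges") (auto simp: open_edges_def)
  then have "AE \<omega> in percolation p. \<forall>e. e \<notin> open_edges \<omega>"
    unfolding AE_all_countable by blast
  then show ?thesis
    by (rule AE_mp) (intro AE_I2, use step_edge in blast)
qed

theorem corollary1p3:
  fixes p :: real
  assumes "critical_prob < p" and "p < 1"
  shows "AE \<omega> in percolation p.
    (let G = rightmost_graph \<omega>; K = percolation_points \<omega> in
      unique_infinite_succession_line G \<and>
      (\<forall>u\<in>K. \<exists>!u'. u' \<in> K \<and> is_successor G u u') \<and>
      (\<forall>u'\<in>K. \<exists>!u. u \<in> K \<and> is_predecessor G u' u) \<and>
      (\<forall>u\<in>K. predecessor (successor u G) G = u \<and> successor (predecessor u G) G = u) \<and>
      (\<forall>u\<in>K. K = {successor_iterate n u G | n :: int. True}))"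
proof -
  have "AE \<omega> in percolation p. \<forall>v\<in>percolation_points \<omega>.
      \<not> ancient \<omega> v \<and> (\<exists>n. \<not> rightmost_descendant \<omega> n v)"
  proof (cases "p \<le> 0")
    case True
    then show ?thesis by (rule AE_mp[OF AE_no_percolation_point]) simp
  next
    case False
    then have p: "0 < p" "p < 1" using assms by simp_all
    show ?thesis
      using AE_not_ancient[OF p] AE_not_always_rightmost[OF p] by eventually_elim blast
  qed
  then show ?thesis
  proof (rule AE_mp, intro AE_I2 impI)
    fix \<omega>
    assume "\<forall>v\<in>percolation_points \<omega>. \<not> ancient \<omega> v \<and> (\<exists>n. \<not> rightmost_descendant \<omega> n v)"
    then show "let G = rightmost_graph \<omega>; K = percolation_points \<omega> in
      unique_infinite_succession_line G \<and>
      (\<forall>u\<in>K. \<exists>!u'. u' \<in> K \<and> is_successor G u u') \<and>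
      (\<forall>u'\<in>K. \<exists>!u. u \<in> K \<and> is_predecessor G u' u) \<and>
      (\<forall>u\<in>K. predecessor (successor u G) G = u \<and> successor (predecessor u G) G = u) \<and>
      (\<forall>u\<in>K. K = {successor_iterate n u G | n :: int. True})"
      unfolding Let_def by (intro succession_structure) blast+
  qed
qed

end
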